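(* Let $r\in\{0,1\}$, $s\ge 0$, $t\ge 1$ be integers with $r+s\ge 1$, let $m_1,\ldots,m_s\ge 3$ be integers, and let $n_1,\ldots,n_t\ge 2$ be integers with $2n_1\le\cdots\le 2n_t$. Set \[ P=P_2^r\square P_{m_1}\square\cdots\square P_{m_s},\qquad E=C_{2n_1}\square\cdots\square C_{2n_t},\qquad G=P\square E, \] and let $c_4(E)$ be the number of $C_4$ factors of $E$, i.e. the number of indices $i$ with $n_i=2$. \begin{enumerate} \item If $P\cong P_2$ and $t=1$, then $q_B(G)=4$. \item If $P\cong P_2$ and $E\cong C_4\square C_4$, then $q_B(G)=6$. \item In each of the following cases, $\Delta(G)\le q_B(G)\le\Delta(G)+1$: \begin{enumerate} \item $P\cong P_2$, $c_4(E)=0$, and $t\ge 2$; \item $P\cong P_2$ and $E\cong C_4\square C_4\square C_{4n+2}$ for some integer $n\ge 1$; \item $P\cong P_2\square P_m$ for some integer $m\ge 3$ and $c_4(E)=0$. \end{enumerate} \item In all remaining cases (that is, whenever none of the cases in items 1, 2, 3 applies), $q_B(G)=\Delta(G)$. \end{enumerate}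
   Context: All graphs are finite and simple. An edge-coloring is proper if incident (i.e. sharing an endpoint) distinct edges receive distinct colors. A set of edges is rainbow if its edges have pairwise distinct colors. A B-coloring of a graph $G$ is a proper edge-coloring of $G$ in which every $4$-cycle (cycle subgraph of length $4$, not necessarily induced) is rainbow. The B-coloring number $q_B(G)$ is the minimum number of colors in a B-coloring of $G$. $\Delta(G)$ is the maximum degree of $G$. $P_n$ and $C_n$ denote the path and the cycle on $n$ vertices. The Cartesian product $G\square H$ has vertex set $V(G)\times V(H)$, with $(u,x)$ adjacent to $(v,y)$ if and only if $uv\in E(G)$ and $x=y$, or $u=v$ and $xy\in E(H)$. $P_2^r$ denotes the Cartesian product of $r$ copies of $P_2$; for $r=0$ this factor is absent, and for $s=0$ the factors $P_{m_i}$ are absent. *)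

theory Defs
  imports Main
begin

record 'a graph =
  verts :: "'a set"
  edges :: "'a set set"

definition fin_simple_graph :: "'a graph \<Rightarrow> bool" where
  "fin_simple_graph G \<longleftrightarrow> finite (verts G) \<and> (\<forall>e\<in>edges G. e \<subseteq> verts G \<and> card e = 2)"

definition degree :: "'a graph \<Rightarrow> 'a \<Rightarrow> nat" where
  "degree G v = card {e \<in> edges G. v \<in> e}"

definition max_degree :: "'a graph \<Rightarrow> nat" where
  "max_degree G = Max (degree G ` verts G)"

definition graph_iso :: "'a graph \<Rightarrow> 'b graph \<Rightarrow> bool"  (infix "\<simeq>" 50) where
  "G \<simeq> H \<longleftrightarrow> (\<exists>f. bij_betw f (verts G) (verts H) \<and>
     (\<forall>u\<in>verts G. \<forall>v\<in>verts G. {u, v} \<in> edges G \<longleftrightarrow> {f u, f v} \<in> edges H))"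

definition path_graph :: "nat \<Rightarrow> nat graph" where
  "path_graph n = \<lparr>verts = {..<n}, edges = {{i, Suc i} | i. Suc i < n}\<rparr>"

text \<open>Meaningful for n at least 3 only: smaller n would yield loops or the single edge.\<close>

definition cycle_graph :: "nat \<Rightarrow> nat graph" where
  "cycle_graph n = \<lparr>verts = {..<n}, edges = {{i, Suc i mod n} | i. i < n}\<rparr>"

definition cart_prod :: "'a graph \<Rightarrow> 'b graph \<Rightarrow> ('a \<times> 'b) graph"  (infixr "\<box>" 70) where
  "G \<box> H = \<lparr>verts = verts G \<times> verts H,
     edges = {{(u, x), (v, y)} | u v x y.
       u \<in> verts G \<and> v \<in> verts G \<and> x \<in> verts H \<and> y \<in> verts H \<and>
       ({u, v} \<in> edges G \<and> x = y \<or> u = v \<and> {x, y} \<in> edges H)}\<rparr>"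

definition map_graph :: "('a \<Rightarrow> 'b) \<Rightarrow> 'a graph \<Rightarrow> 'b graph" where
  "map_graph f G = \<lparr>verts = f ` verts G, edges = (\<lambda>e. f ` e) ` edges G\<rparr>"

text \<open>The number of factors of an iterated product varies, so its vertices are lists with one
  entry per factor. The empty product is the one-vertex graph, a unit for the binary product up
  to isomorphism; factors that are absent simply do not occur in the list.\<close>

fun cart_prods :: "'a graph list \<Rightarrow> 'a list graph" where
  "cart_prods [] = \<lparr>verts = {[]}, edges = {}\<rparr>"
| "cart_prods (G # Gs) = map_graph (\<lambda>(x, xs). x # xs) (G \<box> cart_prods Gs)"

definition proper_edge_coloring :: "'a graph \<Rightarrow> ('a set \<Rightarrow> nat) \<Rightarrow> bool" where
  "proper_edge_coloring G c \<longleftrightarrow>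
     (\<forall>e\<in>edges G. \<forall>f\<in>edges G. e \<noteq> f \<and> e \<inter> f \<noteq> {} \<longrightarrow> c e \<noteq> c f)"

definition rainbow :: "('a set \<Rightarrow> nat) \<Rightarrow> 'a set set \<Rightarrow> bool" where
  "rainbow c F \<longleftrightarrow> inj_on c F"

text \<open>The edge sets of the subgraphs of G that are cycles of length 4.\<close>

definition four_cycles :: "'a graph \<Rightarrow> 'a set set set" where
  "four_cycles G = {{{w, x}, {x, y}, {y, z}, {z, w}} | w x y z.
     distinct [w, x, y, z] \<and> {{w, x}, {x, y}, {y, z}, {z, w}} \<subseteq> edges G}"

definition B_coloring :: "'a graph \<Rightarrow> ('a set \<Rightarrow> nat) \<Rightarrow> bool" where
  "B_coloring G c \<longleftrightarrow> proper_edge_coloring G c \<and> (\<forall>F\<in>four_cycles G. rainbow c F)"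

text \<open>The colors of c are those actually used on edges. Since graphs are finite, taking them to
  be natural numbers loses no generality, and the minimum is attained.\<close>

definition q_B :: "'a graph \<Rightarrow> nat" where
  "q_B G = (LEAST k. \<exists>c. B_coloring G c \<and> card (c ` edges G) = k)"

lemma fin_simple_path_graph: "fin_simple_graph (path_graph n)"
  by (auto simp: fin_simple_graph_def path_graph_def)

lemma fin_simple_cycle_graph:
  assumes "n \<ge> 3" shows "fin_simple_graph (cycle_graph n)"
proof -
  have "i \<noteq> Suc i mod n" if "i < n" for i
    using assms that by (cases "Suc i = n") auto
  with assms show ?thesis by (auto simp: fin_simple_graph_def cycle_graph_def)
qed

lemma fin_simple_cart_prod:
  assumes "fin_simple_graph G" "fin_simple_graph H" shows "fin_simple_graph (G \<box> H)"
proof -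
  have "u \<noteq> v" if "{u, v} \<in> edges G" for u v
    using assms(1) that by (force simp: fin_simple_graph_def)
  moreover have "x \<noteq> y" if "{x, y} \<in> edges H" for x y
    using assms(2) that by (force simp: fin_simple_graph_def)
  ultimately show ?thesis
    using assms by (auto simp: fin_simple_graph_def cart_prod_def card_insert_if)
qed

lemma fin_simple_cart_prods:
  assumes "\<forall>G\<in>set Gs. fin_simple_graph G" shows "fin_simple_graph (cart_prods Gs)"
  using assms
proof (induction Gs)
  case Nil
  show ?case by (simp add: fin_simple_graph_def)
next
  case (Cons G Gs)
  have inj: "inj_on (\<lambda>(x, xs). x # xs) A" for A :: "('a \<times> 'a list) set"
    by (auto simp: inj_on_def)
  have "fin_simple_graph (G \<box> cart_prods Gs)"
    using Cons by (simp add: fin_simple_cart_prod)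
  then show ?case
    by (auto simp: fin_simple_graph_def map_graph_def card_image[OF inj])
qed

lemma B_coloring_exists:
  assumes "fin_simple_graph G" shows "\<exists>c. B_coloring G c"
proof -
  have "finite (edges G)"
    using assms by (auto simp: fin_simple_graph_def intro: finite_subset[of _ "Pow (verts G)"])
  then obtain c :: "'a set \<Rightarrow> nat" where c: "inj_on c (edges G)"
    using finite_imp_inj_to_nat_seg by blast
  have "rainbow c F" if "F \<in> four_cycles G" for F
  proof -
    have "F \<subseteq> edges G"
      using that unfolding four_cycles_def by blast
    then show ?thesis
      unfolding rainbow_def by (rule inj_on_subset[OF c])
  qed
  then have "B_coloring G c"
    using c by (auto simp: B_coloring_def proper_edge_coloring_def dest: inj_onD)
  then show ?thesis by blast
qed

end

theory Submission
  imports Defs "HOL-Library.Multiset"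
begin

text \<open>Pulling colors back along locally injective homomorphisms preserves B-colorings, so a path may
  be replaced by any long cycle or by the 4-cycle, a cycle of length divisible by 4 by the 4-cycle,
  and the 4-cycle by the square of an edge. Palettes of bipartite factors add up: along the edges
  of one factor the colors of the other one are permuted without fixed points. Hence finitely many
  products have to be colored by hand. Their vertices are labelled by vectors over the field with
  two elements such that an edge of direction i changes the label by the i-th vector of a list, and
  the colors are read off a table indexed by label and direction.

  The lower bounds are the maximum degree, the four colors of a 4-cycle, and for the 5-dimensional
  cube an exhaustive search over the permutations of the directions induced by a 5-coloring at
  each vertex.\<close>

section \<open>B-colorings as functions on adjacent pairs\<close>

text \<open>Two small factors obstruct an additive count. A palette of size 1 has no permutation
  without fixed points, so the edge \<open>path_graph 2\<close> cannot be added at the price of one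
  color; and \<open>cycle_graph 4\<close> has degree 2 but needs four colors by itself. Longer
  paths, longer even cycles and pairs of 4-cycles are colored with exactly their degree, which is
  even. So the factors are split into blocks, each colored with as many colors as its degree. A
  4-cycle needs a partner, hence the parity of their number matters, and the edge needs a block of
  degree 5, 7 or 9 that leaves an even number of 4-cycles behind. The exceptional items of the
  theorem are the products in which no such block fits; there one color is wasted on the edge.

  The tables stay small because labels need not be injective. Distinct directions only have to carry
  distinct vectors where they can span a 4-cycle, so all seven directions of the 7-dimensional cube
  fit into three bits, and eight rows color its 128 vertices. The two directions of a long cycle may
  even share a vector, which makes one table serve all lengths.\<close>

definition adj :: "'a graph \<Rightarrow> 'a \<Rightarrow> 'a \<Rightarrow> bool" where
  "adj G u v \<longleftrightarrow> {u, v} \<in> edges G"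

lemma adj_sym: "adj G u v \<Longrightarrow> adj G v u"
  by (simp add: adj_def insert_commute)

lemma adj_irrefl: "fin_simple_graph G \<Longrightarrow> adj G u v \<Longrightarrow> u \<noteq> v"
  by (force simp: fin_simple_graph_def adj_def)

lemma adj_verts: "fin_simple_graph G \<Longrightarrow> adj G u v \<Longrightarrow> u \<in> verts G \<and> v \<in> verts G"
  by (force simp: fin_simple_graph_def adj_def)

lemma edge_adjE:
  assumes "fin_simple_graph G" "e \<in> edges G"
  obtains u v where "e = {u, v}" "u \<noteq> v" "adj G u v"
  using assms by (metis adj_def card_2_iff fin_simple_graph_def)

lemma edge_adj_atE:
  assumes "fin_simple_graph G" "e \<in> edges G" "u \<in> e"
  obtains v where "e = {u, v}" "adj G u v"
proof -
  obtain x y where "e = {x, y}" "adj G x y"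
    using edge_adjE[OF assms(1,2)] by metis
  then show ?thesis
    using that[of x] that[of y] assms(3) adj_sym[of G x y] by (auto simp: insert_commute)
qed

lemma finite_edges: "fin_simple_graph G \<Longrightarrow> finite (edges G)"
  by (auto simp: fin_simple_graph_def intro: finite_subset[of _ "Pow (verts G)"])

text \<open>Functions of two vertices allow colorings of products to be defined by cases on the
  coordinates. Once the coloring is proper, a rainbow 4-cycle only requires opposite edges to
  differ. The palette below \<open>k\<close> need not be exhausted, and values off the edges are
  free.\<close>

definition B_fun :: "'a graph \<Rightarrow> nat \<Rightarrow> ('a \<Rightarrow> 'a \<Rightarrow> nat) \<Rightarrow> bool" where
  "B_fun G k f \<longleftrightarrow>
    (\<forall>x y. adj G x y \<longrightarrow> f x y = f y x \<and> f x y < k) \<and>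
    (\<forall>x y z. adj G x y \<and> adj G x z \<and> y \<noteq> z \<longrightarrow> f x y \<noteq> f x z) \<and>
    (\<forall>w x y z. adj G w x \<and> adj G x y \<and> adj G y z \<and> adj G z w \<and> w \<noteq> y \<and> x \<noteq> z \<longrightarrow> f w x \<noteq> f y z)"

definition B_colorable :: "'a graph \<Rightarrow> nat \<Rightarrow> bool" where
  "B_colorable G k \<longleftrightarrow> (\<exists>f. B_fun G k f)"

lemma B_colorableI:
  assumes "\<And>x y. adj G x y \<Longrightarrow> f x y = f y x" and "\<And>x y. adj G x y \<Longrightarrow> f x y < k"
    and "\<And>x y z. adj G x y \<Longrightarrow> adj G x z \<Longrightarrow> y \<noteq> z \<Longrightarrow> f x y \<noteq> f x z"
    and "\<And>w x y z. adj G w x \<Longrightarrow> adj G x y \<Longrightarrow> adj G y z \<Longrightarrow> adj G z w \<Longrightarrow> w \<noteq> y \<Longrightarrow> x \<noteq> z \<Longrightarrow>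
      f w x \<noteq> f y z"
  shows "B_colorable G k"
  unfolding B_colorable_def B_fun_def
  by (intro exI[of _ f] conjI allI impI; (elim conjE)?; (rule assms, assumption+))

lemma B_funD:
  assumes "B_fun G k f"
  shows "adj G x y \<Longrightarrow> f x y = f y x" and "adj G x y \<Longrightarrow> f x y < k"
    and "adj G x y \<Longrightarrow> adj G x z \<Longrightarrow> y \<noteq> z \<Longrightarrow> f x y \<noteq> f x z"
    and "adj G w x \<Longrightarrow> adj G x y \<Longrightarrow> adj G y z \<Longrightarrow> adj G z w \<Longrightarrow> w \<noteq> y \<Longrightarrow> x \<noteq> z \<Longrightarrow> f w x \<noteq> f y z"
  using assms unfolding B_fun_def by blast+

lemma B_colorableE:
  assumes "B_colorable G k" obtains f where "B_fun G k f"
  using assms unfolding B_colorable_def by blast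

lemma B_fun_of_B_coloring:
  assumes G: "fin_simple_graph G" and c: "B_coloring G c" and k: "c ` edges G \<subseteq> {..<k}"
  shows "B_fun G k (\<lambda>x y. c {x, y})"
proof -
  have proper: "c {x, y} \<noteq> c {x, z}" if "adj G x y" "adj G x z" "y \<noteq> z" for x y z
    using c that unfolding B_coloring_def proper_edge_coloring_def adj_def
    by (metis Int_insert_left_if1 doubleton_eq_iff insertI1 insert_not_empty)
  have opp: "c {w, x} \<noteq> c {y, z}"
    if a: "adj G w x" "adj G x y" "adj G y z" "adj G z w" "w \<noteq> y" "x \<noteq> z" for w x y z
  proof -
    let ?F = "{{w, x}, {x, y}, {y, z}, {z, w}}"
    have ne: "distinct [w, x, y, z]"
      using a adj_irrefl[OF G] by (metis adj_sym distinct_length_2_or_more distinct_singleton)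
    have "?F \<in> four_cycles G"
      unfolding four_cycles_def using ne a unfolding adj_def by blast
    then have "inj_on c ?F"
      using c by (metis B_coloring_def rainbow_def)
    moreover have "{w, x} \<noteq> {y, z}"
      using ne by (auto simp: doubleton_eq_iff)
    ultimately show ?thesis
      by (metis inj_onD insertCI)
  qed
  show ?thesis
    unfolding B_fun_def using k proper opp by (auto simp: adj_def insert_commute)
qed

lemma B_coloring_of_B_fun:
  assumes G: "fin_simple_graph G" and f: "B_fun G k f"
  shows "\<exists>c. B_coloring G c \<and> c ` edges G \<subseteq> {..<k}"
proof -
  \<comment> \<open>Symmetry of \<open>f\<close> on adjacent vertices makes the description unique
    on edges; elsewhere its value is irrelevant.\<close>
  define c where "c e = (THE n. \<forall>x y. e = {x, y} \<longrightarrow> n = f x y)" for e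
  have c: "c {x, y} = f x y" if "adj G x y" for x y
    unfolding c_def using B_funD(1)[OF f that] by (intro the_equality) (auto simp: doubleton_eq_iff)
  have proper: "c e \<noteq> c e'"
    if ee: "e \<in> edges G" "e' \<in> edges G" "e \<noteq> e'" "e \<inter> e' \<noteq> {}" for e e'
  proof -
    obtain x where x: "x \<in> e" "x \<in> e'"
      using ee by blast
    obtain y where y: "e = {x, y}" "adj G x y"
      using edge_adj_atE[OF G ee(1) x(1)] .
    obtain z where z: "e' = {x, z}" "adj G x z"
      using edge_adj_atE[OF G ee(2) x(2)] .
    have "f x y \<noteq> f x z"
      using B_funD(3)[OF f y(2) z(2)] y(1) z(1) ee(3) by blast
    then show ?thesis
      using c y z by simp
  qed
  have "rainbow c F" if "F \<in> four_cycles G" for F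
  proof -
    obtain w x y z where F: "F = {{w, x}, {x, y}, {y, z}, {z, w}}"
      and d: "distinct [w, x, y, z]" and E: "{{w, x}, {x, y}, {y, z}, {z, w}} \<subseteq> edges G"
      using \<open>F \<in> four_cycles G\<close> unfolding four_cycles_def mem_Collect_eq
      by (elim exE conjE) (rule that)
    have a: "adj G w x" "adj G x y" "adj G y z" "adj G z w"
      using E by (simp_all add: adj_def)
    have "f w x \<noteq> f y z" "f x y \<noteq> f z w"
      using B_funD(4)[OF f] a d by auto
    then have "c {w, x} \<noteq> c {y, z}" "c {x, y} \<noteq> c {z, w}"
      using c a by simp_all
    moreover have "c {w, x} \<noteq> c {x, y}" "c {x, y} \<noteq> c {y, z}" "c {y, z} \<noteq> c {z, w}" "c {z, w} \<noteq> c {w, x}"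
      using a d by - (rule proper; auto simp: adj_def doubleton_eq_iff)+
    ultimately show ?thesis
      unfolding rainbow_def F by auto
  qed
  then have "B_coloring G c"
    unfolding B_coloring_def proper_edge_coloring_def using proper by blast
  moreover have "c e < k" if "e \<in> edges G" for e
    using edge_adjE[OF G that] c B_funD(2)[OF f] by metis
  ultimately show ?thesis by (auto intro!: exI[of _ c])
qed

text \<open>\<open>q_B\<close> counts the colors that occur, which may be arbitrary numbers; an
  injective renaming moves them to an initial segment.\<close>

lemma B_colorable_q_B:
  assumes G: "fin_simple_graph G"
  shows "B_colorable G (q_B G)"
proof -
  have "\<exists>k c. B_coloring G c \<and> card (c ` edges G) = k"
    using B_coloring_exists[OF G] by simp
  from LeastI_ex[OF this] have "\<exists>c. B_coloring G c \<and> card (c ` edges G) = q_B G"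
    unfolding q_B_def .
  then obtain c where c: "B_coloring G c" and k: "card (c ` edges G) = q_B G"
    by blast
  obtain h where "bij_betw h (c ` edges G) {0..<card (c ` edges G)}"
    using ex_bij_betw_finite_nat[OF finite_imageI[OF finite_edges[OF G]]] by blast
  then have h: "bij_betw h (c ` edges G) {..<q_B G}"
    by (simp add: k atLeast0LessThan)
  then have inj: "inj_on h (c ` edges G)"
    by (rule bij_betw_imp_inj_on)
  have "rainbow (h \<circ> c) F" if "F \<in> four_cycles G" for F
  proof -
    have "F \<subseteq> edges G"
      using that unfolding four_cycles_def by blast
    then have "inj_on h (c ` F)"
      using inj_on_subset[OF inj] by blast
    moreover have "inj_on c F"
      using c that by (simp add: B_coloring_def rainbow_def)
    ultimately show ?thesis
      unfolding rainbow_def by (rule comp_inj_on[rotated])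
  qed
  moreover have "proper_edge_coloring G (h \<circ> c)"
    using c by (simp add: B_coloring_def proper_edge_coloring_def inj_on_eq_iff[OF inj])
  ultimately have "B_coloring G (h \<circ> c)"
    by (simp add: B_coloring_def)
  moreover have "(h \<circ> c) ` edges G \<subseteq> {..<q_B G}"
    using h by (auto simp: bij_betw_def)
  ultimately show ?thesis
    using B_fun_of_B_coloring[OF G] unfolding B_colorable_def by blast
qed

lemma q_B_le:
  assumes "fin_simple_graph G" "B_colorable G k"
  shows "q_B G \<le> k"
proof -
  obtain c where c: "B_coloring G c" "c ` edges G \<subseteq> {..<k}"
    using assms B_coloring_of_B_fun unfolding B_colorable_def by blast
  have "q_B G \<le> card (c ` edges G)"
    unfolding q_B_def using c(1) by (intro Least_le exI[of _ c] conjI refl)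
  also have "\<dots> \<le> k"
    using card_mono[OF _ c(2)] by simp
  finally show ?thesis .
qed

text \<open>Needed for the product of an edge and one cycle, where the degree bound only gives
  3.\<close>

lemma B_colorable_four_cycle:
  assumes k: "B_colorable G k" and a: "adj G w x" "adj G x y" "adj G y z" "adj G z w" "w \<noteq> y" "x \<noteq> z"
  shows "4 \<le> k"
proof -
  obtain f where f: "B_fun G k f"
    using k unfolding B_colorable_def by blast
  note a' = a a(1-4)[THEN adj_sym]
  note s = B_funD(1)[OF f]
  have ne: "f w x \<noteq> f x y" "f x y \<noteq> f y z" "f y z \<noteq> f z w" "f z w \<noteq> f w x"
    using B_funD(3)[OF f a'(7,2)] B_funD(3)[OF f a'(8,3)] B_funD(3)[OF f a'(9,4)] B_funD(3)[OF f a'(10,1)]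
      s[OF a(1)] s[OF a(2)] s[OF a(3)] s[OF a(4)] a(5,6) by auto
  have "f w x \<noteq> f y z" "f x y \<noteq> f z w"
    using B_funD(4)[OF f] a by auto
  then have "card {f w x, f x y, f y z, f z w} = 4"
    using ne by auto
  moreover have "{f w x, f x y, f y z, f z w} \<subseteq> {..<k}"
    using B_funD(2)[OF f] a by auto
  ultimately show ?thesis
    by (metis card_lessThan card_mono finite_lessThan)
qed

lemma degree_conv_neighbors:
  assumes G: "fin_simple_graph G"
  shows "degree G v = card {w. adj G v w}"
proof -
  have "{e \<in> edges G. v \<in> e} = (\<lambda>w. {v, w}) ` {w. adj G v w}"
    by (auto simp: adj_def elim: edge_adj_atE[OF G])
  moreover have "inj_on (\<lambda>w. {v, w}) {w. adj G v w}"
    by (auto simp: inj_on_def doubleton_eq_iff)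
  ultimately show ?thesis
    unfolding degree_def by (simp add: card_image)
qed

lemma finite_neighbors: "fin_simple_graph G \<Longrightarrow> finite {w. adj G v w}"
  by (rule finite_subset[of _ "verts G"]) (auto simp: adj_verts, simp add: fin_simple_graph_def)

lemma max_degree_le_B_colorable:
  assumes G: "fin_simple_graph G" and ne: "verts G \<noteq> {}" and k: "B_colorable G k"
  shows "max_degree G \<le> k"
proof -
  obtain f where f: "B_fun G k f"
    using k unfolding B_colorable_def by blast
  have "degree G v \<le> k" for v
  proof -
    have "inj_on (f v) {w. adj G v w}"
      using B_funD(3)[OF f] by (metis inj_onI mem_Collect_eq)
    moreover have "f v ` {w. adj G v w} \<subseteq> {..<k}"
      using B_funD(2)[OF f] by auto
    ultimately show ?thesis
      unfolding degree_conv_neighbors[OF G] by (metis card_inj_on_le card_lessThan finite_lessThan)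
  qed
  then show ?thesis
    using G ne by (auto simp: max_degree_def fin_simple_graph_def)
qed

section \<open>Products and isomorphisms\<close>

lemma adj_cart_prod:
  "adj (G \<box> H) (u, x) (v, y) \<longleftrightarrow> u \<in> verts G \<and> v \<in> verts G \<and> x \<in> verts H \<and> y \<in> verts H \<and>
    (adj G u v \<and> x = y \<or> u = v \<and> adj H x y)"
  by (auto simp: adj_def cart_prod_def doubleton_eq_iff insert_commute)

lemma verts_cart_prod [simp]: "verts (G \<box> H) = verts G \<times> verts H"
  by (simp add: cart_prod_def)

lemma graph_isoI:
  assumes "bij_betw f (verts G) (verts H)"
    and "\<And>u v. u \<in> verts G \<Longrightarrow> v \<in> verts G \<Longrightarrow> adj G u v \<longleftrightarrow> adj H (f u) (f v)"
  shows "G \<simeq> H"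
  using assms unfolding graph_iso_def adj_def by (intro exI[of _ f]) simp

lemma graph_isoE:
  assumes "G \<simeq> H"
  obtains f where "bij_betw f (verts G) (verts H)"
    and "\<And>u v. u \<in> verts G \<Longrightarrow> v \<in> verts G \<Longrightarrow> adj G u v \<longleftrightarrow> adj H (f u) (f v)"
  using assms unfolding graph_iso_def adj_def by (elim exE conjE) simp

lemma graph_iso_refl: "G \<simeq> G"
  by (rule graph_isoI[of id]) auto

lemma graph_iso_sym:
  assumes "G \<simeq> H" shows "H \<simeq> G"
proof -
  obtain f where f: "bij_betw f (verts G) (verts H)"
    and a: "\<And>u v. u \<in> verts G \<Longrightarrow> v \<in> verts G \<Longrightarrow> adj G u v \<longleftrightarrow> adj H (f u) (f v)"
    by (rule graph_isoE[OF assms]) (rule that)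
  let ?g = "inv_into (verts G) f"
  have g: "bij_betw ?g (verts H) (verts G)"
    by (rule bij_betw_inv_into[OF f])
  show ?thesis
  proof (rule graph_isoI[OF g])
    fix u v assume "u \<in> verts H" "v \<in> verts H"
    then show "adj H u v \<longleftrightarrow> adj G (?g u) (?g v)"
      using a[of "?g u" "?g v"] bij_betw_apply[OF g] bij_betw_inv_into_right[OF f] by simp
  qed
qed

lemma graph_iso_trans [trans]:
  assumes "G \<simeq> H" "H \<simeq> K" shows "G \<simeq> K"
proof -
  obtain f where f: "bij_betw f (verts G) (verts H)"
    and a: "\<And>u v. u \<in> verts G \<Longrightarrow> v \<in> verts G \<Longrightarrow> adj G u v \<longleftrightarrow> adj H (f u) (f v)"
    by (rule graph_isoE[OF assms(1)]) (rule that)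
  obtain g where g: "bij_betw g (verts H) (verts K)"
    and b: "\<And>u v. u \<in> verts H \<Longrightarrow> v \<in> verts H \<Longrightarrow> adj H u v \<longleftrightarrow> adj K (g u) (g v)"
    by (rule graph_isoE[OF assms(2)]) (rule that)
  show ?thesis
    using a b bij_betw_apply[OF f] by (intro graph_isoI[OF bij_betw_trans[OF f g]]) simp
qed

lemma cart_prod_cong:
  assumes "G \<simeq> G'" "H \<simeq> H'" shows "G \<box> H \<simeq> G' \<box> H'"
proof -
  obtain f where f: "bij_betw f (verts G) (verts G')"
    and a: "\<And>u v. u \<in> verts G \<Longrightarrow> v \<in> verts G \<Longrightarrow> adj G u v \<longleftrightarrow> adj G' (f u) (f v)"
    by (rule graph_isoE[OF assms(1)]) (rule that)
  obtain g where g: "bij_betw g (verts H) (verts H')"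
    and b: "\<And>u v. u \<in> verts H \<Longrightarrow> v \<in> verts H \<Longrightarrow> adj H u v \<longleftrightarrow> adj H' (g u) (g v)"
    by (rule graph_isoE[OF assms(2)]) (rule that)
  have fg: "bij_betw (map_prod f g) (verts (G \<box> H)) (verts (G' \<box> H'))"
    using bij_betw_map_prod[OF f g] by simp
  show ?thesis
    using a b bij_betw_apply[OF f] bij_betw_apply[OF g]
      inj_on_eq_iff[OF bij_betw_imp_inj_on[OF f]] inj_on_eq_iff[OF bij_betw_imp_inj_on[OF g]]
    by (intro graph_isoI[OF fg]) (auto simp: adj_cart_prod)
qed

lemma cart_prod_commute: "G \<box> H \<simeq> H \<box> G"
  by (rule graph_isoI[of prod.swap]) (auto simp: adj_cart_prod bij_betw_def inj_on_def image_iff)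

lemma cart_prod_assoc: "(G \<box> H) \<box> K \<simeq> G \<box> (H \<box> K)"
  by (rule graph_isoI[of "\<lambda>((u, v), w). (u, (v, w))"])
    (force simp: adj_cart_prod bij_betw_def inj_on_def image_iff)+

section \<open>Iterated products and reordering of their factors\<close>

lemma inj_Cons: "inj (\<lambda>(x, xs). x # xs)"
  by (auto simp: inj_on_def)

lemma adj_cart_prods_Cons:
  "adj (cart_prods (G # Gs)) (x # xs) (y # ys) \<longleftrightarrow> adj (G \<box> cart_prods Gs) (x, xs) (y, ys)"
proof -
  let ?f = "\<lambda>(x, xs). x # xs"
  have "inj ((`) ?f)"
    by (rule injI) (simp add: inj_image_eq_iff[OF inj_Cons])
  moreover have "{x # xs, y # ys} = ?f ` {(x, xs), (y, ys)}"
    by simp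
  ultimately show ?thesis
    using inj_image_mem_iff[of "(`) ?f" "{(x, xs), (y, ys)}" "edges (G \<box> cart_prods Gs)"]
    by (simp only: adj_def map_graph_def cart_prods.simps graph.simps)
qed

lemma verts_cart_prods_Cons: "verts (cart_prods (G # Gs)) = (\<lambda>(x, xs). x # xs) ` (verts G \<times> verts (cart_prods Gs))"
  by (simp add: map_graph_def)

lemma cart_prods_Cons: "G \<box> cart_prods Gs \<simeq> cart_prods (G # Gs)"
  by (rule graph_isoI[of "\<lambda>(x, xs). x # xs"])
    (auto simp: bij_betw_def verts_cart_prods_Cons adj_cart_prods_Cons inj_on_def simp del: cart_prods.simps)

lemma adj_no_edges [simp]: "\<not> adj \<lparr>verts = V, edges = {}\<rparr> u v"
  by (simp add: adj_def)

lemma cart_prod_Nil: "cart_prods [] \<box> G \<simeq> G"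
  by (rule graph_isoI[of snd]) (auto simp: bij_betw_def adj_cart_prod inj_on_def image_iff)

lemma cart_prods_append: "cart_prods Gs \<box> cart_prods Hs \<simeq> cart_prods (Gs @ Hs)"
proof (induction Gs)
  case Nil
  show ?case
    using cart_prod_Nil by simp
next
  case (Cons G Gs)
  have "cart_prods (G # Gs) \<box> cart_prods Hs \<simeq> (G \<box> cart_prods Gs) \<box> cart_prods Hs"
    by (intro cart_prod_cong graph_iso_refl graph_iso_sym[OF cart_prods_Cons])
  also have "\<dots> \<simeq> G \<box> (cart_prods Gs \<box> cart_prods Hs)"
    by (rule cart_prod_assoc)
  also have "\<dots> \<simeq> G \<box> cart_prods (Gs @ Hs)"
    by (intro cart_prod_cong graph_iso_refl Cons.IH)
  also have "\<dots> \<simeq> cart_prods ((G # Gs) @ Hs)"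
    using cart_prods_Cons by simp
  finally show ?case .
qed

lemma cart_prods_Cons_cong:
  assumes "cart_prods Gs \<simeq> cart_prods Hs" shows "cart_prods (G # Gs) \<simeq> cart_prods (G # Hs)"
  using graph_iso_trans[OF graph_iso_sym[OF cart_prods_Cons]
      graph_iso_trans[OF cart_prod_cong[OF graph_iso_refl assms] cart_prods_Cons]] .

lemma cart_prods_swap: "cart_prods (G # H # Gs) \<simeq> cart_prods (H # G # Gs)"
proof -
  have *: "cart_prods (G # H # Gs) \<simeq> (G \<box> H) \<box> cart_prods Gs" for G H
  proof -
    have "cart_prods (G # H # Gs) \<simeq> G \<box> cart_prods (H # Gs)"
      by (rule graph_iso_sym[OF cart_prods_Cons])
    also have "\<dots> \<simeq> G \<box> (H \<box> cart_prods Gs)"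
      by (intro cart_prod_cong graph_iso_refl graph_iso_sym[OF cart_prods_Cons])
    also have "\<dots> \<simeq> (G \<box> H) \<box> cart_prods Gs"
      by (rule graph_iso_sym[OF cart_prod_assoc])
    finally show ?thesis .
  qed
  have "cart_prods (G # H # Gs) \<simeq> (G \<box> H) \<box> cart_prods Gs"
    by (rule *)
  also have "\<dots> \<simeq> (H \<box> G) \<box> cart_prods Gs"
    by (intro cart_prod_cong graph_iso_refl cart_prod_commute)
  also have "\<dots> \<simeq> cart_prods (H # G # Gs)"
    by (rule graph_iso_sym[OF *])
  finally show ?thesis .
qed

lemma cart_prods_middle: "cart_prods (G # As @ Bs) \<simeq> cart_prods (As @ G # Bs)"
proof (induction As)
  case Nil
  show ?case by (simp add: graph_iso_refl)
next
  case (Cons A As)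
  have "cart_prods (G # (A # As) @ Bs) \<simeq> cart_prods (A # G # As @ Bs)"
    using cart_prods_swap by simp
  also have "\<dots> \<simeq> cart_prods ((A # As) @ G # Bs)"
    using cart_prods_Cons_cong[OF Cons.IH] by simp
  finally show ?case .
qed

text \<open>Makes a list of factors as good as a multiset, so that any choice of blocks is justified
  by an equation between multisets.\<close>

lemma cart_prods_mset_cong:
  assumes "mset Gs = mset Hs" shows "cart_prods Gs \<simeq> cart_prods Hs"
  using assms
proof (induction Gs arbitrary: Hs)
  case Nil
  then show ?case by (simp add: graph_iso_refl)
next
  case (Cons G Gs)
  then have "G \<in> set Hs"
    by (metis list.set_intros(1) mset_eq_setD)
  then obtain As Bs where Hs: "Hs = As @ G # Bs"
    by (meson split_list)
  then have "cart_prods Gs \<simeq> cart_prods (As @ Bs)"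
    using Cons.prems by (intro Cons.IH) simp
  from cart_prods_Cons_cong[OF this] show ?case
    unfolding Hs by (rule graph_iso_trans) (rule cart_prods_middle)
qed

section \<open>Pulling colorings back\<close>

text \<open>Local injectivity suffices: the image of a 4-cycle is again a 4-cycle, because its opposite
  vertices are distinct neighbors of a common vertex.\<close>

definition lhom :: "'a graph \<Rightarrow> 'b graph \<Rightarrow> bool"  (infix "\<leadsto>" 50) where
  "G \<leadsto> H \<longleftrightarrow> (\<exists>h. (\<forall>v\<in>verts G. h v \<in> verts H) \<and> (\<forall>u v. adj G u v \<longrightarrow> adj H (h u) (h v)) \<and>
    (\<forall>u v w. adj G u v \<and> adj G u w \<and> v \<noteq> w \<longrightarrow> h v \<noteq> h w))"

lemma lhomI:
  assumes "\<And>v. v \<in> verts G \<Longrightarrow> h v \<in> verts H" "\<And>u v. adj G u v \<Longrightarrow> adj H (h u) (h v)"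
    "\<And>u v w. adj G u v \<Longrightarrow> adj G u w \<Longrightarrow> h v = h w \<Longrightarrow> v = w"
  shows "G \<leadsto> H"
  using assms unfolding lhom_def by (intro exI[of _ h]) auto

lemma lhomE:
  assumes "G \<leadsto> H"
  obtains h where "\<And>v. v \<in> verts G \<Longrightarrow> h v \<in> verts H" "\<And>u v. adj G u v \<Longrightarrow> adj H (h u) (h v)"
    "\<And>u v w. adj G u v \<Longrightarrow> adj G u w \<Longrightarrow> h v = h w \<Longrightarrow> v = w"
  using assms unfolding lhom_def by blast

lemma B_colorable_lhom:
  assumes "G \<leadsto> H" "B_colorable H k" shows "B_colorable G k"
proof -
  obtain h where a: "\<And>u v. adj G u v \<Longrightarrow> adj H (h u) (h v)"
    and i: "\<And>u v w. adj G u v \<Longrightarrow> adj G u w \<Longrightarrow> h v = h w \<Longrightarrow> v = w"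
    by (rule lhomE[OF assms(1)]) (rule that)
  obtain f where f: "B_fun H k f"
    using assms(2) by (rule B_colorableE)
  show ?thesis
  proof (rule B_colorableI[of G "\<lambda>x y. f (h x) (h y)"])
    fix w x y z
    assume *: "adj G w x" "adj G x y" "adj G y z" "adj G z w" "w \<noteq> y" "x \<noteq> z"
    then have "h w \<noteq> h y" "h x \<noteq> h z"
      using i[of x w y] i[of w x z] adj_sym[of G w x] adj_sym[of G z w] by auto
    then show "f (h w) (h x) \<noteq> f (h y) (h z)"
      using * by (intro B_funD(4)[OF f] a)
  next
    fix x y z
    assume *: "adj G x y" "adj G x z" "y \<noteq> z"
    then have "h y \<noteq> h z"
      using i by blast
    then show "f (h x) (h y) \<noteq> f (h x) (h z)"
      using * by (intro B_funD(3)[OF f] a)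
  qed (intro B_funD(1,2)[OF f] a; assumption)+
qed

lemma lhom_refl: "G \<leadsto> G"
  by (rule lhomI[of _ id]) auto

lemma lhom_trans [trans]:
  assumes "G \<leadsto> H" "H \<leadsto> K" shows "G \<leadsto> K"
proof -
  obtain g where g: "\<And>v. v \<in> verts G \<Longrightarrow> g v \<in> verts H" "\<And>u v. adj G u v \<Longrightarrow> adj H (g u) (g v)"
    "\<And>u v w. adj G u v \<Longrightarrow> adj G u w \<Longrightarrow> g v = g w \<Longrightarrow> v = w"
    by (rule lhomE[OF assms(1)]) (rule that)
  obtain h where h: "\<And>v. v \<in> verts H \<Longrightarrow> h v \<in> verts K" "\<And>u v. adj H u v \<Longrightarrow> adj K (h u) (h v)"
    "\<And>u v w. adj H u v \<Longrightarrow> adj H u w \<Longrightarrow> h v = h w \<Longrightarrow> v = w"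
    by (rule lhomE[OF assms(2)]) (rule that)
  show ?thesis
  proof (rule lhomI[of _ "\<lambda>v. h (g v)"])
    fix u v w
    assume "adj G u v" "adj G u w" "h (g v) = h (g w)"
    then show "v = w"
      using g(3) h(3)[OF g(2) g(2)] by blast
  qed (use g h in auto)
qed

lemma graph_iso_lhom:
  assumes "fin_simple_graph G" "G \<simeq> H" shows "G \<leadsto> H"
proof -
  obtain f where f: "bij_betw f (verts G) (verts H)"
    and a: "\<And>u v. u \<in> verts G \<Longrightarrow> v \<in> verts G \<Longrightarrow> adj G u v \<longleftrightarrow> adj H (f u) (f v)"
    by (rule graph_isoE[OF assms(2)]) (rule that)
  show ?thesis
    using a adj_verts[OF assms(1)] bij_betw_apply[OF f] inj_onD[OF bij_betw_imp_inj_on[OF f]]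
    by (intro lhomI[of _ f]) blast+
qed

lemma B_colorable_iso: "fin_simple_graph G \<Longrightarrow> G \<simeq> H \<Longrightarrow> B_colorable H k \<Longrightarrow> B_colorable G k"
  using graph_iso_lhom B_colorable_lhom by blast

text \<open>Two neighbors reached in different factors stay distinct because the target factors have
  no loops: moving along an edge changes the image of exactly one coordinate.\<close>

lemma lhom_cart_prod:
  assumes "G \<leadsto> G'" "H \<leadsto> H'" "fin_simple_graph G'" "fin_simple_graph H'"
  shows "G \<box> H \<leadsto> G' \<box> H'"
proof -
  obtain g where g: "\<And>v. v \<in> verts G \<Longrightarrow> g v \<in> verts G'" "\<And>u v. adj G u v \<Longrightarrow> adj G' (g u) (g v)"
    "\<And>u v w. adj G u v \<Longrightarrow> adj G u w \<Longrightarrow> g v = g w \<Longrightarrow> v = w"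
    by (rule lhomE[OF assms(1)]) (rule that)
  obtain h where h: "\<And>v. v \<in> verts H \<Longrightarrow> h v \<in> verts H'" "\<And>u v. adj H u v \<Longrightarrow> adj H' (h u) (h v)"
    "\<And>u v w. adj H u v \<Longrightarrow> adj H u w \<Longrightarrow> h v = h w \<Longrightarrow> v = w"
    by (rule lhomE[OF assms(2)]) (rule that)
  have ne: "adj G u v \<Longrightarrow> g u \<noteq> g v" "adj H x y \<Longrightarrow> h x \<noteq> h y" for u v x y
    using adj_irrefl[OF assms(3)] adj_irrefl[OF assms(4)] g(2) h(2) by blast+
  show ?thesis
  proof (rule lhomI[of _ "map_prod g h"])
    fix p q r
    assume *: "adj (G \<box> H) p q" "adj (G \<box> H) p r" "map_prod g h q = map_prod g h r"
    obtain u x v y w z where [simp]: "p = (u, x)" "q = (v, y)" "r = (w, z)"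
      by (metis surj_pair)
    from * ne(1)[of u v] ne(1)[of u w] ne(2)[of x y] ne(2)[of x z] g(3)[of u v w] h(3)[of x y z]
    show "q = r"
      by (auto simp: adj_cart_prod)
  qed (use g h in \<open>auto simp: adj_cart_prod\<close>)
qed

section \<open>Bipartite products\<close>

definition bipartite :: "'a graph \<Rightarrow> bool" where
  "bipartite G \<longleftrightarrow> (\<exists>p. \<forall>u v. adj G u v \<longrightarrow> p u \<noteq> (p v :: bool))"

lemma bipartite_lhom:
  assumes "G \<leadsto> H" "bipartite H" shows "bipartite G"
proof -
  obtain h where a: "\<And>u v. adj G u v \<Longrightarrow> adj H (h u) (h v)"
    by (rule lhomE[OF assms(1)]) (rule that)
  obtain p where "\<forall>u v. adj H u v \<longrightarrow> p u \<noteq> (p v :: bool)"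
    using assms(2) unfolding bipartite_def by (rule exE)
  then show ?thesis
    unfolding bipartite_def using a by (intro exI[of _ "\<lambda>v. p (h v)"]) simp
qed

lemma bipartite_cart_prod:
  assumes "bipartite G" "bipartite H" shows "bipartite (G \<box> H)"
proof -
  obtain p where p: "\<And>u v. adj G u v \<Longrightarrow> p u \<noteq> (p v :: bool)"
    using assms(1) unfolding bipartite_def by blast
  obtain q where q: "\<And>u v. adj H u v \<Longrightarrow> q u \<noteq> (q v :: bool)"
    using assms(2) unfolding bipartite_def by blast
  show ?thesis
    unfolding bipartite_def
    by (rule exI[of _ "\<lambda>(u, x). p u \<noteq> q x"]) (auto simp: adj_cart_prod dest: p q)
qed

lemma bipartite_cart_prods:
  assumes "\<forall>G\<in>set Gs. fin_simple_graph G \<and> bipartite G"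
  shows "bipartite (cart_prods Gs)"
  using assms
proof (induction Gs)
  case Nil
  show ?case by (simp add: bipartite_def)
next
  case (Cons G Gs)
  have "fin_simple_graph (cart_prods (G # Gs))"
    using Cons.prems by (intro fin_simple_cart_prods) auto
  moreover have "bipartite (G \<box> cart_prods Gs)"
    using Cons by (intro bipartite_cart_prod) simp_all
  ultimately show ?case
    by (rule bipartite_lhom[OF graph_iso_lhom[OF _ graph_iso_sym[OF cart_prods_Cons]]])
qed

text \<open>The flag will be the parity of the position in the other factor. On the numbers below
  \<open>k\<close> the cyclic successor is a permutation, and it has no fixed point unless
  \<open>k = 1\<close>.\<close>

definition shift :: "nat \<Rightarrow> bool \<Rightarrow> nat \<Rightarrow> nat" where
  "shift k b a = (if b then Suc a mod k else a)"

lemma shift_less: "a < k \<Longrightarrow> shift k b a < k"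
  by (simp add: shift_def)

lemma shift_inj: "a < k \<Longrightarrow> a' < k \<Longrightarrow> shift k b a = shift k b a' \<longleftrightarrow> a = a'"
  by (auto simp: shift_def mod_Suc split: if_splits)

lemma shift_neq: "a < k \<Longrightarrow> k \<noteq> 1 \<Longrightarrow> b \<noteq> b' \<Longrightarrow> shift k b a \<noteq> shift k b' a"
  by (auto simp: shift_def mod_Suc split: if_splits)

text \<open>The colors of each factor are permuted without fixed points when moving along an edge of
  the other factor; a palette of size 0 belongs to a factor without edges.\<close>

lemma B_colorable_cart_prod:
  assumes "bipartite G" "bipartite H" "B_colorable G k" "B_colorable H l" "k \<noteq> 1" "l \<noteq> 1"
  shows "B_colorable (G \<box> H) (k + l)"
proof -
  obtain p where p: "\<And>u v. adj G u v \<Longrightarrow> p u \<noteq> (p v :: bool)"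
    using assms(1) unfolding bipartite_def by blast
  obtain q where q: "\<And>u v. adj H u v \<Longrightarrow> q u \<noteq> (q v :: bool)"
    using assms(2) unfolding bipartite_def by blast
  obtain f where f: "B_fun G k f"
    using assms(3) by (rule B_colorableE)
  obtain g where g: "B_fun H l g"
    using assms(4) by (rule B_colorableE)
  \<comment> \<open>Edges along \<open>G\<close> use the colors below \<open>k\<close>, edges along
    \<open>H\<close> the next \<open>l\<close> ones, each rotated by the parity of the coordinate
    that stays fixed. Equal second coordinates recognize the edges along \<open>G\<close>, as
    \<open>H\<close> has no loops.\<close>
  define F where "F s t = (if snd s = snd t then shift k (q (snd s)) (f (fst s) (fst t))
    else k + shift l (p (fst s)) (g (snd s) (snd t)))" for s t
  have F1: "F (u, x) (v, x) = shift k (q x) (f u v)" for u v x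
    by (simp add: F_def)
  have F2: "F (u, x) (u, y) = k + shift l (p u) (g x y)" if "adj H x y" for u x y
    using q[OF that] by (auto simp: F_def)
  have F1_less: "F (u, x) (v, x) < k" if "adj G u v" for u v x
    unfolding F1 by (intro shift_less B_funD(2)[OF f] that)
  have F2_less: "F (u, x) (u, y) < k + l" "k \<le> F (u, x) (u, y)" if "adj H x y" for u x y
    unfolding F2[OF that] using shift_less[OF B_funD(2)[OF g that]] by simp_all
  have irr: "\<not> adj G u u" "\<not> adj H x x" for u x
    using p q by blast+
  have adjE: thesis
    if "adj (G \<box> H) s t" and "\<And>u v x. s = (u, x) \<Longrightarrow> t = (v, x) \<Longrightarrow> adj G u v \<Longrightarrow> thesis"
      and "\<And>u x y. s = (u, x) \<Longrightarrow> t = (u, y) \<Longrightarrow> adj H x y \<Longrightarrow> thesis" for s t thesis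
    using that by (cases s; cases t) (auto simp: adj_cart_prod)
  show ?thesis
  proof (rule B_colorableI[of _ F])
    fix s t assume a: "adj (G \<box> H) s t"
    show "F s t = F t s"
      using a
    proof (rule adjE)
      fix u v x assume *: "s = (u, x)" "t = (v, x)" "adj G u v"
      then show ?thesis using B_funD(1)[OF f *(3)] by (simp add: F1)
    next
      fix u x y assume *: "s = (u, x)" "t = (u, y)" "adj H x y"
      then show ?thesis using B_funD(1)[OF g *(3)] by (simp add: F2 adj_sym)
    qed
    show "F s t < k + l"
      using a F1_less F2_less(1) by (auto elim!: adjE simp: trans_less_add1)
  next
    fix s t r assume a: "adj (G \<box> H) s t" "adj (G \<box> H) s r" "t \<noteq> r"
    show "F s t \<noteq> F s r"
      using a(1)
    proof (rule adjE)
      fix u v x assume 1: "s = (u, x)" "t = (v, x)" "adj G u v"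
      show ?thesis
        using a(2)
      proof (rule adjE)
        fix u' v' x' assume 2: "s = (u', x')" "r = (v', x')" "adj G u' v'"
        then have "f u v \<noteq> f u v'"
          using 1 a(3) by (intro B_funD(3)[OF f]) auto
        then show ?thesis
          using 1 2 B_funD(2)[OF f] by (simp add: F1 shift_inj)
      next
        fix u' x' y' assume 2: "s = (u', x')" "r = (u', y')" "adj H x' y'"
        then show ?thesis
          using 1 F1_less[OF 1(3), of x] F2_less(2)[OF 2(3), of u'] by simp
      qed
    next
      fix u x y assume 1: "s = (u, x)" "t = (u, y)" "adj H x y"
      show ?thesis
        using a(2)
      proof (rule adjE)
        fix u' v' x' assume 2: "s = (u', x')" "r = (v', x')" "adj G u' v'"
        then show ?thesis
          using 1 F1_less[OF 2(3), of x'] F2_less(2)[OF 1(3), of u] by simp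
      next
        fix u' x' y' assume 2: "s = (u', x')" "r = (u', y')" "adj H x' y'"
        then have "g x y \<noteq> g x y'"
          using 1 a(3) by (intro B_funD(3)[OF g]) auto
        then show ?thesis
          using 1 2 B_funD(2)[OF g] by (simp add: F2 shift_inj)
      qed
    qed
  next
    fix w x y z
    assume a: "adj (G \<box> H) w x" "adj (G \<box> H) x y" "adj (G \<box> H) y z" "adj (G \<box> H) z w" "w \<noteq> y" "x \<noteq> z"
    obtain w1 w2 x1 x2 y1 y2 z1 z2 where [simp]: "w = (w1, w2)" "x = (x1, x2)" "y = (y1, y2)" "z = (z1, z2)"
      by (metis surj_pair)
    show "F w x \<noteq> F y z"
    proof (cases "w2 = x2")
      case True
      then have wx: "adj G w1 x1"
        using a(1) irr by (auto simp: adj_cart_prod)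
      show ?thesis
      proof (cases "y2 = z2")
        case yz: True
        then have yz1: "adj G y1 z1"
          using a(3) irr by (auto simp: adj_cart_prod)
        show ?thesis
        proof (cases "x2 = y2")
          case xy: True
          then have "adj G x1 y1" "adj G z1 w1" "w1 \<noteq> y1" "x1 \<noteq> z1"
            using a irr True yz by (auto simp: adj_cart_prod)
          then have "f w1 x1 \<noteq> f y1 z1"
            using wx yz1 by (intro B_funD(4)[OF f])
          then show ?thesis
            using True yz xy B_funD(2)[OF f] wx yz1 by (simp add: F1 shift_inj)
        next
          case False
          \<comment> \<open>The 4-cycle is spanned by one edge of each factor. Its two edges along
            \<open>G\<close> have the same color under \<open>f\<close>, but exactly one of them is
            rotated.\<close>
          then have "x1 = y1" "adj H x2 y2" "z1 = w1"
            using a True yz by (auto simp: adj_cart_prod)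
          then show ?thesis
            using True yz wx B_funD(1)[OF f wx] shift_neq[OF B_funD(2)[OF f wx] assms(5) q]
            by (auto simp: F1)
        qed
      next
        case False
        then have "adj H y2 z2" "y1 = z1"
          using a(3) by (auto simp: adj_cart_prod)
        then show ?thesis
          using F2_less(2)[of y2 z2 y1] F1_less[OF wx, of w2] True by auto
      qed
    next
      case False
      then have wx: "adj H w2 x2" "w1 = x1"
        using a(1) by (auto simp: adj_cart_prod)
      show ?thesis
      proof (cases "y2 = z2")
        case True
        then have "adj G y1 z1"
          using a(3) irr by (auto simp: adj_cart_prod)
        then show ?thesis
          using F1_less[of y1 z1 y2] F2_less(2)[OF wx(1), of w1] True wx by auto
      next
        case yz: False
        then have yz1: "adj H y2 z2" "y1 = z1"
          using a(3) by (auto simp: adj_cart_prod)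
        show ?thesis
        proof (cases "x1 = y1")
          case xy: True
          then have "adj H x2 y2" "adj H z2 w2" "w2 \<noteq> y2" "x2 \<noteq> z2"
            using a irr wx yz1 by (auto simp: adj_cart_prod)
          then have "g w2 x2 \<noteq> g y2 z2"
            using wx yz1 by (intro B_funD(4)[OF g])
          then show ?thesis
            using xy B_funD(2)[OF g] wx yz1 by (simp add: F2 shift_inj)
        next
          case False
          then have "x2 = y2" "adj G x1 y1" "z2 = w2"
            using a wx yz1 by (auto simp: adj_cart_prod)
          then show ?thesis
            using wx yz1 B_funD(1)[OF g wx(1)] shift_neq[OF B_funD(2)[OF g wx(1)] assms(6) p]
            by (auto simp: F2 adj_sym)
        qed
      qed
    qed
  qed
qed

lemma B_colorable_cart_prods_append:
  assumes "\<forall>G\<in>set (Gs @ Hs). fin_simple_graph G \<and> bipartite G"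
    and "B_colorable (cart_prods Gs) k" "B_colorable (cart_prods Hs) l" "k \<noteq> 1" "l \<noteq> 1"
  shows "B_colorable (cart_prods (Gs @ Hs)) (k + l)"
proof -
  have "B_colorable (cart_prods Gs \<box> cart_prods Hs) (k + l)"
    using assms by (intro B_colorable_cart_prod bipartite_cart_prods) auto
  then show ?thesis
    using assms(1) by (intro B_colorable_iso[OF fin_simple_cart_prods graph_iso_sym[OF cart_prods_append]]) auto
qed

section \<open>Degrees\<close>

lemma degree_cart_prod:
  assumes "fin_simple_graph G" "fin_simple_graph H" "u \<in> verts G" "x \<in> verts H"
  shows "degree (G \<box> H) (u, x) = degree G u + degree H x"
proof -
  have "{p. adj (G \<box> H) (u, x) p} = (\<lambda>v. (v, x)) ` {v. adj G u v} \<union> (\<lambda>y. (u, y)) ` {y. adj H x y}"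
    using assms adj_verts[OF assms(1)] adj_verts[OF assms(2)] by (auto simp: adj_cart_prod)
  moreover have "(\<lambda>v. (v, x)) ` {v. adj G u v} \<inter> (\<lambda>y. (u, y)) ` {y. adj H x y} = {}"
    using adj_irrefl[OF assms(1)] by auto
  moreover have "card ((\<lambda>v. (v, x)) ` {v. adj G u v}) = card {v. adj G u v}"
    by (intro card_image inj_onI) simp
  moreover have "card ((\<lambda>y. (u, y)) ` {y. adj H x y}) = card {y. adj H x y}"
    by (intro card_image inj_onI) simp
  ultimately show ?thesis
    using assms by (simp add: degree_conv_neighbors fin_simple_cart_prod card_Un_disjoint finite_neighbors)
qed

lemma max_degree_eqI:
  assumes "fin_simple_graph G" "v \<in> verts G" "degree G v = d" "\<And>u. u \<in> verts G \<Longrightarrow> degree G u \<le> d"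
  shows "max_degree G = d"
  using assms unfolding max_degree_def fin_simple_graph_def by (intro Max_eqI) auto

lemma max_degreeE:
  assumes "fin_simple_graph G" "verts G \<noteq> {}"
  obtains v where "v \<in> verts G" "degree G v = max_degree G"
  using Max_in[of "degree G ` verts G"] assms unfolding max_degree_def fin_simple_graph_def
  by (metis finite_imageI image_iff image_is_empty)

lemma degree_le_max_degree: "fin_simple_graph G \<Longrightarrow> v \<in> verts G \<Longrightarrow> degree G v \<le> max_degree G"
  unfolding max_degree_def fin_simple_graph_def by simp

lemma max_degree_cart_prod:
  assumes "fin_simple_graph G" "fin_simple_graph H" "verts G \<noteq> {}" "verts H \<noteq> {}"
  shows "max_degree (G \<box> H) = max_degree G + max_degree H"
proof -
  obtain u where u: "u \<in> verts G" "degree G u = max_degree G"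
    using max_degreeE[OF assms(1,3)] .
  obtain x where x: "x \<in> verts H" "degree H x = max_degree H"
    using max_degreeE[OF assms(2,4)] .
  show ?thesis
    using u x degree_le_max_degree[OF assms(1)] degree_le_max_degree[OF assms(2)]
    by (intro max_degree_eqI[of _ "(u, x)"])
      (auto simp: assms fin_simple_cart_prod degree_cart_prod add_mono)
qed

lemma degree_iso:
  assumes "fin_simple_graph G" "fin_simple_graph H" "bij_betw f (verts G) (verts H)" "u \<in> verts G"
    and "\<And>u v. u \<in> verts G \<Longrightarrow> v \<in> verts G \<Longrightarrow> adj G u v \<longleftrightarrow> adj H (f u) (f v)"
  shows "degree H (f u) = degree G u"
proof -
  have "{y. adj H (f u) y} = f ` {v. adj G u v}"
  proof (intro subset_antisym subsetI)
    fix y assume "y \<in> {y. adj H (f u) y}"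
    then have y: "adj H (f u) y"
      by simp
    then obtain v where v: "v \<in> verts G" "y = f v"
      using adj_verts[OF assms(2)] bij_betw_imp_surj_on[OF assms(3)] by blast
    then show "y \<in> f ` {v. adj G u v}"
      using y assms(5)[OF assms(4) v(1)] by simp
  next
    fix y assume "y \<in> f ` {v. adj G u v}"
    then obtain v where v: "adj G u v" "y = f v"
      by blast
    then show "y \<in> {y. adj H (f u) y}"
      using assms(5)[OF assms(4), of v] adj_verts[OF assms(1)] by simp
  qed
  moreover have "inj_on f {v. adj G u v}"
    using adj_verts[OF assms(1)] by (intro inj_on_subset[OF bij_betw_imp_inj_on[OF assms(3)]]) auto
  ultimately show ?thesis
    by (simp add: degree_conv_neighbors assms(1,2) card_image)
qed

lemma max_degree_iso:
  assumes "fin_simple_graph G" "fin_simple_graph H" "G \<simeq> H"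
  shows "max_degree G = max_degree H"
proof -
  obtain f where f: "bij_betw f (verts G) (verts H)"
    and a: "\<And>u v. u \<in> verts G \<Longrightarrow> v \<in> verts G \<Longrightarrow> adj G u v \<longleftrightarrow> adj H (f u) (f v)"
    by (rule graph_isoE[OF assms(3)]) (rule that)
  have "degree H ` verts H = degree G ` verts G"
    by (simp add: bij_betw_imp_surj_on[OF f, symmetric] image_image degree_iso[OF assms(1,2) f _ a]
        cong: image_cong)
  then show ?thesis
    by (simp add: max_degree_def)
qed

lemma verts_cart_prods_nonempty: "\<forall>G\<in>set Gs. verts G \<noteq> {} \<Longrightarrow> verts (cart_prods Gs) \<noteq> {}"
  by (induction Gs) (auto simp: map_graph_def)

lemma card_verts_iso: "G \<simeq> H \<Longrightarrow> card (verts G) = card (verts H)"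
  unfolding graph_iso_def using bij_betw_same_card by blast

lemma card_verts_cart_prods: "card (verts (cart_prods Gs)) = prod_list (map (\<lambda>G. card (verts G)) Gs)"
proof (induction Gs)
  case (Cons G Gs)
  then show ?case
    using card_verts_iso[OF cart_prods_Cons[of G Gs]] by (simp add: card_cartesian_product)
qed simp

lemma max_degree_cart_prods:
  assumes "\<forall>G\<in>set Gs. fin_simple_graph G \<and> verts G \<noteq> {}"
  shows "max_degree (cart_prods Gs) = sum_list (map max_degree Gs)"
  using assms
proof (induction Gs)
  case Nil
  show ?case by (simp add: max_degree_def degree_def)
next
  case (Cons G Gs)
  have s: "fin_simple_graph (cart_prods Gs)" "fin_simple_graph (cart_prods (G # Gs))"
    using Cons.prems by (auto intro!: fin_simple_cart_prods simp del: cart_prods.simps)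
  have "max_degree (cart_prods (G # Gs)) = max_degree (G \<box> cart_prods Gs)"
    using s Cons.prems by (intro max_degree_iso[symmetric] cart_prods_Cons fin_simple_cart_prod) auto
  also have "\<dots> = max_degree G + max_degree (cart_prods Gs)"
    using s Cons.prems by (intro max_degree_cart_prod verts_cart_prods_nonempty) auto
  finally show ?case
    using Cons by simp
qed

section \<open>Paths and cycles\<close>

lemma verts_path_graph [simp]: "verts (path_graph n) = {..<n}"
  by (simp add: path_graph_def)

lemma verts_cycle_graph [simp]: "verts (cycle_graph n) = {..<n}"
  by (simp add: cycle_graph_def)

lemma adj_path_graph: "adj (path_graph n) i j \<longleftrightarrow> i < n \<and> j < n \<and> (j = Suc i \<or> i = Suc j)"
  by (auto simp: adj_def path_graph_def doubleton_eq_iff)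

lemma adj_cycle_graph:
  "adj (cycle_graph n) i j \<longleftrightarrow> i < n \<and> j < n \<and> (j = Suc i mod n \<or> i = Suc j mod n)"
  by (auto simp: adj_def cycle_graph_def doubleton_eq_iff)

lemma bipartite_path_graph: "bipartite (path_graph n)"
  unfolding bipartite_def by (rule exI[of _ even]) (auto simp: adj_path_graph)

lemma even_Suc_mod_even: "even n \<Longrightarrow> even (Suc i mod n) \<longleftrightarrow> odd i" for i n :: nat
  by (simp add: dvd_mod_iff)

lemma bipartite_cycle_graph: "even n \<Longrightarrow> bipartite (cycle_graph n)"
  unfolding bipartite_def
  by (rule exI[of _ even]) (auto simp: adj_cycle_graph even_Suc_mod_even)

lemma max_degree_path_graph_2: "max_degree (path_graph 2) = 1"
proof (rule max_degree_eqI[of _ 0])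
  have "{w. adj (path_graph 2) v w} = {1 - v}" if "v < 2" for v
    using that by (auto simp: adj_path_graph less_2_cases_iff)
  then show "degree (path_graph 2) 0 = 1" "u \<in> verts (path_graph 2) \<Longrightarrow> degree (path_graph 2) u \<le> 1" for u
    by (simp_all add: degree_conv_neighbors fin_simple_path_graph)
qed (simp_all add: fin_simple_path_graph)

lemma max_degree_path_graph:
  assumes "m \<ge> 3" shows "max_degree (path_graph m) = 2"
proof (rule max_degree_eqI[of _ 1])
  have "{w. adj (path_graph m) 1 w} = {0, 2}"
    using assms by (auto simp: adj_path_graph)
  then show "degree (path_graph m) 1 = 2"
    by (simp add: degree_conv_neighbors fin_simple_path_graph)
  fix u
  have "{w. adj (path_graph m) u w} \<subseteq> {u - 1, Suc u}"
    by (auto simp: adj_path_graph)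
  then have "card {w. adj (path_graph m) u w} \<le> card {u - 1, Suc u}"
    by (intro card_mono) auto
  also have "\<dots> \<le> 2"
    by (simp add: card_insert_if)
  finally show "degree (path_graph m) u \<le> 2"
    by (simp add: degree_conv_neighbors fin_simple_path_graph)
qed (use assms in \<open>simp_all add: fin_simple_path_graph\<close>)

lemma cycle_graph_pred: "i < n \<Longrightarrow> j < n \<Longrightarrow> i = Suc j mod n \<longleftrightarrow> j = (if i = 0 then n - 1 else i - 1)" for n :: nat
  by (auto simp: mod_Suc)

lemma adj_cycle_graph':
  assumes "v < n"
  shows "adj (cycle_graph n) v w \<longleftrightarrow> w = Suc v mod n \<or> w = (if v = 0 then n - 1 else v - 1)"
proof -
  have "adj (cycle_graph n) v w \<longleftrightarrow> w < n \<and> (w = Suc v mod n \<or> v = Suc w mod n)"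
    using assms by (simp add: adj_cycle_graph)
  also have "\<dots> \<longleftrightarrow> w < n \<and> (w = Suc v mod n \<or> w = (if v = 0 then n - 1 else v - 1))"
    using cycle_graph_pred[OF assms] by metis
  finally show ?thesis
    using assms by auto
qed

lemma max_degree_cycle_graph:
  assumes "n \<ge> 3" shows "max_degree (cycle_graph n) = 2"
proof -
  have "{w. adj (cycle_graph n) v w} = {Suc v mod n, if v = 0 then n - 1 else v - 1}" if "v < n" for v
    unfolding adj_cycle_graph'[OF that] by blast
  moreover have "Suc v mod n \<noteq> (if v = 0 then n - 1 else v - 1)" if "v < n" for v
    using that assms by (auto simp: mod_Suc)
  ultimately have "degree (cycle_graph n) v = 2" if "v < n" for v
    using that by (simp add: degree_conv_neighbors fin_simple_cycle_graph assms)
  then show ?thesis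
    using assms by (intro max_degree_eqI[of _ 0]) (simp_all add: fin_simple_cycle_graph)
qed

text \<open>The path is wound around the cycle; the two neighbors of a vertex are two steps apart,
  which is not 0 modulo 4.\<close>

lemma path_lhom_cycle_4: "path_graph m \<leadsto> cycle_graph 4"
proof (rule lhomI[of _ "\<lambda>i. i mod 4"])
  show "adj (cycle_graph 4) (u mod 4) (v mod 4)" if "adj (path_graph m) u v" for u v
    using that by (auto simp: adj_path_graph adj_cycle_graph mod_Suc_eq)
  show "v = w" if "adj (path_graph m) u v" "adj (path_graph m) u w" "v mod 4 = w mod 4" for u v w
  proof -
    have "Suc (Suc i) mod 4 \<noteq> i mod 4" for i :: nat
      by presburger
    then show ?thesis
      using that by (auto simp: adj_path_graph) metis
  qed
qed simp

lemma path_lhom_cycle: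
  assumes "n \<ge> m" "n \<ge> 3" shows "path_graph m \<leadsto> cycle_graph n"
  using assms by (intro lhomI[of _ id]) (auto simp: adj_path_graph adj_cycle_graph)

text \<open>This is the covering map. Successor and predecessor of a vertex differ by 2 modulo 4.
  Lengths that are 2 modulo 4 do not wrap around evenly, which is the origin of the cycles of length
  \<open>4 * n + 2\<close> among the exceptions.\<close>

lemma cycle_lhom_cycle_4:
  assumes "4 dvd n" "n > 0" shows "cycle_graph n \<leadsto> cycle_graph 4"
proof (rule lhomI[of _ "\<lambda>i. i mod 4"])
  have *: "Suc i mod n mod 4 = Suc (i mod 4) mod 4" for i
    using assms(1) by (simp add: mod_mod_cancel mod_Suc_eq)
  show "adj (cycle_graph 4) (u mod 4) (v mod 4)" if "adj (cycle_graph n) u v" for u v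
    using that * by (auto simp: adj_cycle_graph)
  fix u v w
  assume a: "adj (cycle_graph n) u v" "adj (cycle_graph n) u w" "v mod 4 = w mod 4"
  have ne: False if "x = Suc u mod n" "u = Suc y mod n" "x mod 4 = y mod 4" for x y
  proof -
    have "y mod 4 = Suc (Suc (y mod 4) mod 4) mod 4"
      using that * by metis
    then show False by presburger
  qed
  from a(1,2) consider "v = Suc u mod n" "w = Suc u mod n" | "v = Suc u mod n" "u = Suc w mod n"
    | "u = Suc v mod n" "w = Suc u mod n" | "u = Suc v mod n" "u = Suc w mod n" "u < n" "v < n" "w < n"
    unfolding adj_cycle_graph by blast
  then show "v = w"
  proof cases
    case 1
    then show ?thesis by simp
  next
    case 2
    from ne[OF this a(3)] show ?thesis ..
  next
    case 3
    from ne[OF 3(2,1) a(3)[symmetric]] show ?thesis ..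
  next
    case 4
    then show ?thesis
      using cycle_graph_pred by metis
  qed
qed simp

text \<open>The map walks around the square: (0,0), (1,0), (1,1), (0,1) become 0, 1, 2, 3.\<close>

lemma path_2_path_2_iso_cycle_4: "path_graph 2 \<box> path_graph 2 \<simeq> cycle_graph 4"
proof (rule graph_isoI[of "\<lambda>(a, b). if a = 0 then 3 * b else Suc b"])
  have lt: "{..<2} = {0, 1 :: nat}" "{..<4} = {0, 1, 2, 3 :: nat}"
    by auto
  show "bij_betw (\<lambda>(a, b). if a = 0 then 3 * b else Suc b) (verts (path_graph 2 \<box> path_graph 2)) (verts (cycle_graph 4))"
    by (auto simp: bij_betw_def inj_on_def lt)
qed (auto simp: adj_cart_prod adj_path_graph adj_cycle_graph less_2_cases_iff)

section \<open>Colorings from labels in a binary vector space\<close>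

text \<open>Bit vectors are written as numbers, with XOR as addition. An edge of direction i joins
  vertices whose labels differ by the i-th vector of the list. A long even cycle has two
  directions, alternating along it, which share a vector.\<close>

definition labelling :: "nat \<Rightarrow> 'a graph \<Rightarrow> nat list \<Rightarrow> bool" where
  "labelling n G vs \<longleftrightarrow> (\<exists>L d. (\<forall>u. L u < 2 ^ n) \<and>
    (\<forall>u v. adj G u v \<longrightarrow> d u v = d v u \<and> d u v < length vs \<and> L v = xor (L u) (vs ! d u v)) \<and>
    (\<forall>u v w. adj G u v \<and> adj G u w \<and> v \<noteq> w \<longrightarrow> d u v \<noteq> d u w) \<and>
    (\<forall>w x y z. adj G w x \<and> adj G x y \<and> adj G y z \<and> adj G z w \<and> w \<noteq> y \<and> x \<noteq> z \<longrightarrow>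
      d w x = d y z \<and> vs ! d w x \<noteq> vs ! d x y))"

lemma labellingI:
  fixes d :: "'a \<Rightarrow> 'a \<Rightarrow> nat"
  assumes "\<And>u. L u < 2 ^ n"
    and "\<And>u v. adj G u v \<Longrightarrow> d u v = d v u" and "\<And>u v. adj G u v \<Longrightarrow> d u v < length vs"
    and "\<And>u v. adj G u v \<Longrightarrow> L v = xor (L u) (vs ! d u v)"
    and "\<And>u v w. adj G u v \<Longrightarrow> adj G u w \<Longrightarrow> v \<noteq> w \<Longrightarrow> d u v \<noteq> d u w"
    and "\<And>w x y z. adj G w x \<Longrightarrow> adj G x y \<Longrightarrow> adj G y z \<Longrightarrow> adj G z w \<Longrightarrow> w \<noteq> y \<Longrightarrow> x \<noteq> z \<Longrightarrow>
      d w x = d y z \<and> vs ! d w x \<noteq> vs ! d x y"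
  shows "labelling n G vs"
  unfolding labelling_def
  by (rule exI[of _ L], rule exI[of _ d], intro conjI allI impI; (elim conjE)?)
    (rule assms assms(6)[THEN conjunct1] assms(6)[THEN conjunct2]; assumption)+

lemma labellingE:
  assumes "labelling n G vs"
  obtains L d where "\<And>u. L u < 2 ^ n"
    and "\<And>u v. adj G u v \<Longrightarrow> d u v = d v u" and "\<And>u v. adj G u v \<Longrightarrow> d u v < length vs"
    and "\<And>u v. adj G u v \<Longrightarrow> L v = xor (L u) (vs ! d u v)"
    and "\<And>u v w. adj G u v \<Longrightarrow> adj G u w \<Longrightarrow> v \<noteq> w \<Longrightarrow> d u v \<noteq> d u w"
    and "\<And>w x y z. adj G w x \<Longrightarrow> adj G x y \<Longrightarrow> adj G y z \<Longrightarrow> adj G z w \<Longrightarrow> w \<noteq> y \<Longrightarrow> x \<noteq> z \<Longrightarrow> d w x = d y z"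
    and "\<And>w x y z. adj G w x \<Longrightarrow> adj G x y \<Longrightarrow> adj G y z \<Longrightarrow> adj G z w \<Longrightarrow> w \<noteq> y \<Longrightarrow> x \<noteq> z \<Longrightarrow>
      vs ! d w x \<noteq> vs ! d x y"
proof -
  obtain L d where *: "(\<forall>u. L u < 2 ^ n) \<and>
    (\<forall>u v. adj G u v \<longrightarrow> d u v = d v u \<and> d u v < length vs \<and> L v = xor (L u) (vs ! d u v)) \<and>
    (\<forall>u v w. adj G u v \<and> adj G u w \<and> v \<noteq> w \<longrightarrow> d u v \<noteq> d u w) \<and>
    (\<forall>w x y z. adj G w x \<and> adj G x y \<and> adj G y z \<and> adj G z w \<and> w \<noteq> y \<and> x \<noteq> z \<longrightarrow>
      d w x = d y z \<and> vs ! d w x \<noteq> vs ! d x y)"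
    using assms unfolding labelling_def by (elim exE) (rule that)
  show thesis
    by (rule that[of L d]; use * in blast)
qed

lemma labelling_lhom:
  assumes "G \<leadsto> H" "labelling n H vs" shows "labelling n G vs"
proof -
  obtain h where a: "\<And>u v. adj G u v \<Longrightarrow> adj H (h u) (h v)"
    and i: "\<And>u v w. adj G u v \<Longrightarrow> adj G u w \<Longrightarrow> h v = h w \<Longrightarrow> v = w"
    by (rule lhomE[OF assms(1)]) (rule that)
  obtain L d where *: "\<And>u. L u < 2 ^ n"
    "\<And>u v. adj H u v \<Longrightarrow> d u v = d v u" "\<And>u v. adj H u v \<Longrightarrow> d u v < length vs"
    "\<And>u v. adj H u v \<Longrightarrow> L v = xor (L u) (vs ! d u v)"
    "\<And>u v w. adj H u v \<Longrightarrow> adj H u w \<Longrightarrow> v \<noteq> w \<Longrightarrow> d u v \<noteq> d u w"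
    "\<And>w x y z. adj H w x \<Longrightarrow> adj H x y \<Longrightarrow> adj H y z \<Longrightarrow> adj H z w \<Longrightarrow> w \<noteq> y \<Longrightarrow> x \<noteq> z \<Longrightarrow> d w x = d y z"
    "\<And>w x y z. adj H w x \<Longrightarrow> adj H x y \<Longrightarrow> adj H y z \<Longrightarrow> adj H z w \<Longrightarrow> w \<noteq> y \<Longrightarrow> x \<noteq> z \<Longrightarrow>
      vs ! d w x \<noteq> vs ! d x y"
    by (rule labellingE[OF assms(2)]) (rule that)
  show ?thesis
  proof (rule labellingI[of "\<lambda>u. L (h u)" _ _ "\<lambda>u v. d (h u) (h v)"])
    fix w x y z
    assume b: "adj G w x" "adj G x y" "adj G y z" "adj G z w" "w \<noteq> y" "x \<noteq> z"
    then have "h w \<noteq> h y" "h x \<noteq> h z"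
      using i[of x w y] i[of w x z] adj_sym[of G w x] adj_sym[of G z w] by auto
    then show "d (h w) (h x) = d (h y) (h z) \<and> vs ! d (h w) (h x) \<noteq> vs ! d (h x) (h y)"
      using *(6,7)[of "h w" "h x" "h y" "h z"] b a by simp
  next
    fix u v w
    assume b: "adj G u v" "adj G u w" "v \<noteq> w"
    then have "h v \<noteq> h w"
      using i by blast
    then show "d (h u) (h v) \<noteq> d (h u) (h w)"
      using b by (intro *(5) a)
  qed (intro *(1-4) a; assumption)+
qed

lemma xor_less_2_power: "a < 2 ^ n \<Longrightarrow> b < 2 ^ n \<Longrightarrow> xor a b < 2 ^ n" for a b :: nat
  by (metis take_bit_nat_eq_self_iff take_bit_xor)

text \<open>Labels of the two coordinates are added. Disjointness of the vector lists is what the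
  last clause of \<open>labelling\<close> asks of 4-cycles spanned by one edge of each
  factor.\<close>

lemma labelling_cart_prod:
  assumes "fin_simple_graph G" "fin_simple_graph H" "labelling n G vs" "labelling n H ws" "set vs \<inter> set ws = {}"
  shows "labelling n (G \<box> H) (vs @ ws)"
proof -
  obtain L d where g: "\<And>u. L u < 2 ^ n"
    "\<And>u v. adj G u v \<Longrightarrow> d u v = d v u" "\<And>u v. adj G u v \<Longrightarrow> d u v < length vs"
    "\<And>u v. adj G u v \<Longrightarrow> L v = xor (L u) (vs ! d u v)"
    "\<And>u v w. adj G u v \<Longrightarrow> adj G u w \<Longrightarrow> v \<noteq> w \<Longrightarrow> d u v \<noteq> d u w"
    "\<And>w x y z. adj G w x \<Longrightarrow> adj G x y \<Longrightarrow> adj G y z \<Longrightarrow> adj G z w \<Longrightarrow> w \<noteq> y \<Longrightarrow> x \<noteq> z \<Longrightarrow> d w x = d y z"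
    "\<And>w x y z. adj G w x \<Longrightarrow> adj G x y \<Longrightarrow> adj G y z \<Longrightarrow> adj G z w \<Longrightarrow> w \<noteq> y \<Longrightarrow> x \<noteq> z \<Longrightarrow>
      vs ! d w x \<noteq> vs ! d x y"
    by (rule labellingE[OF assms(3)]) (rule that)
  obtain M e where h: "\<And>u. M u < 2 ^ n"
    "\<And>u v. adj H u v \<Longrightarrow> e u v = e v u" "\<And>u v. adj H u v \<Longrightarrow> e u v < length ws"
    "\<And>u v. adj H u v \<Longrightarrow> M v = xor (M u) (ws ! e u v)"
    "\<And>u v w. adj H u v \<Longrightarrow> adj H u w \<Longrightarrow> v \<noteq> w \<Longrightarrow> e u v \<noteq> e u w"
    "\<And>w x y z. adj H w x \<Longrightarrow> adj H x y \<Longrightarrow> adj H y z \<Longrightarrow> adj H z w \<Longrightarrow> w \<noteq> y \<Longrightarrow> x \<noteq> z \<Longrightarrow> e w x = e y z"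
    "\<And>w x y z. adj H w x \<Longrightarrow> adj H x y \<Longrightarrow> adj H y z \<Longrightarrow> adj H z w \<Longrightarrow> w \<noteq> y \<Longrightarrow> x \<noteq> z \<Longrightarrow>
      ws ! e w x \<noteq> ws ! e x y"
    by (rule labellingE[OF assms(4)]) (rule that)
  define D where "D s t = (if snd s = snd t then d (fst s) (fst t) else length vs + e (snd s) (snd t))" for s t
  define K where "K s = xor (L (fst s)) (M (snd s))" for s
  have irr: "\<not> adj G u u" "\<not> adj H x x" for u x
    using adj_irrefl[OF assms(1)] adj_irrefl[OF assms(2)] by blast+
  have D1: "D (u, x) (v, x) = d u v" for u v x
    by (simp add: D_def)
  have D2: "D (u, x) (u, y) = length vs + e x y" if "adj H x y" for u x y
    using adj_irrefl[OF assms(2) that] by (simp add: D_def)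
  have n1: "(vs @ ws) ! D (u, x) (v, x) = vs ! d u v" if "adj G u v" for u v x
    using g(3)[OF that] by (simp add: D1 nth_append)
  have n2: "(vs @ ws) ! D (u, x) (u, y) = ws ! e x y" if "adj H x y" for u x y
    using that by (simp add: D2)
  have disj: "vs ! d u v \<noteq> ws ! e x y" if "adj G u v" "adj H x y" for u v x y
    using assms(5) nth_mem[OF g(3)[OF that(1)]] nth_mem[OF h(3)[OF that(2)]] by auto
  have adjE: thesis
    if "adj (G \<box> H) s t" and "\<And>u v x. s = (u, x) \<Longrightarrow> t = (v, x) \<Longrightarrow> adj G u v \<Longrightarrow> thesis"
      and "\<And>u x y. s = (u, x) \<Longrightarrow> t = (u, y) \<Longrightarrow> adj H x y \<Longrightarrow> thesis" for s t thesis
    using that by (cases s; cases t) (auto simp: adj_cart_prod)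
  show ?thesis
  proof (rule labellingI[of K _ _ D])
    show "K s < 2 ^ n" for s
      unfolding K_def by (intro xor_less_2_power g(1) h(1))
    fix s t assume a: "adj (G \<box> H) s t"
    show "D s t = D t s"
      using a
    proof (rule adjE)
      fix u v x assume *: "s = (u, x)" "t = (v, x)" "adj G u v"
      then show ?thesis using g(2)[OF *(3)] by (simp add: D1)
    next
      fix u x y assume *: "s = (u, x)" "t = (u, y)" "adj H x y"
      then show ?thesis using h(2)[OF *(3)] by (simp add: D2 adj_sym)
    qed
    show "D s t < length (vs @ ws)"
      using a
    proof (rule adjE)
      fix u v x assume *: "s = (u, x)" "t = (v, x)" "adj G u v"
      then show ?thesis using g(3)[OF *(3)] by (simp add: D1)
    next
      fix u x y assume *: "s = (u, x)" "t = (u, y)" "adj H x y"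
      then show ?thesis using h(3)[OF *(3)] by (simp add: D2)
    qed
    show "K t = xor (K s) ((vs @ ws) ! D s t)"
      using a
    proof (rule adjE)
      fix u v x assume *: "s = (u, x)" "t = (v, x)" "adj G u v"
      then show ?thesis
        using g(4)[OF *(3)] by (simp add: n1 K_def xor.assoc xor.commute xor.left_commute)
    next
      fix u x y assume *: "s = (u, x)" "t = (u, y)" "adj H x y"
      then show ?thesis
        using h(4)[OF *(3)] by (simp add: n2 K_def xor.assoc)
    qed
  next
    fix s t r assume a: "adj (G \<box> H) s t" "adj (G \<box> H) s r" "t \<noteq> r"
    show "D s t \<noteq> D s r"
      using a(1)
    proof (rule adjE)
      fix u v x assume 1: "s = (u, x)" "t = (v, x)" "adj G u v"
      show ?thesis
        using a(2)
      proof (rule adjE)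
        fix u' v' x' assume 2: "s = (u', x')" "r = (v', x')" "adj G u' v'"
        then have "d u v \<noteq> d u v'"
          using 1 a(3) by (intro g(5)) auto
        then show ?thesis
          using 1 2 by (simp add: D1)
      next
        fix u' x' y' assume 2: "s = (u', x')" "r = (u', y')" "adj H x' y'"
        then show ?thesis
          using 1 g(3)[OF 1(3)] by (auto simp: D1 D2)
      qed
    next
      fix u x y assume 1: "s = (u, x)" "t = (u, y)" "adj H x y"
      show ?thesis
        using a(2)
      proof (rule adjE)
        fix u' v' x' assume 2: "s = (u', x')" "r = (v', x')" "adj G u' v'"
        then show ?thesis
          using 1 g(3)[OF 2(3)] by (auto simp: D1 D2)
      next
        fix u' x' y' assume 2: "s = (u', x')" "r = (u', y')" "adj H x' y'"
        then have "e x y \<noteq> e x y'"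
          using 1 a(3) by (intro h(5)) auto
        then show ?thesis
          using 1 2 by (simp add: D2)
      qed
    qed
  next
    fix w x y z
    assume a: "adj (G \<box> H) w x" "adj (G \<box> H) x y" "adj (G \<box> H) y z" "adj (G \<box> H) z w" "w \<noteq> y" "x \<noteq> z"
    obtain w1 w2 x1 x2 y1 y2 z1 z2 where [simp]: "w = (w1, w2)" "x = (x1, x2)" "y = (y1, y2)" "z = (z1, z2)"
      by (metis surj_pair)
    show "D w x = D y z \<and> (vs @ ws) ! D w x \<noteq> (vs @ ws) ! D x y"
    proof (cases "w2 = x2")
      case True
      then have wx: "adj G w1 x1"
        using a(1) irr by (auto simp: adj_cart_prod)
      show ?thesis
      proof (cases "x2 = y2")
        case xy: True
        then have "adj G x1 y1"
          using a(2) irr by (auto simp: adj_cart_prod)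
        moreover have "y2 = z2" "adj G y1 z1" "adj G z1 w1" "w1 \<noteq> y1" "x1 \<noteq> z1"
          using a irr True xy by (auto simp: adj_cart_prod)
        ultimately show ?thesis
          using True xy wx n1 g(6,7)[of w1 x1 y1 z1] by (simp add: D1)
      next
        case False
        then have "x1 = y1" "adj H x2 y2"
          using a(2) by (auto simp: adj_cart_prod)
        moreover have "y2 = z2" "z1 = w1"
          using a True \<open>x1 = y1\<close> \<open>adj H x2 y2\<close> irr by (auto simp: adj_cart_prod)
        moreover have "(vs @ ws) ! D w x \<noteq> (vs @ ws) ! D x y"
          using n1[OF wx, of x2] n2[OF \<open>adj H x2 y2\<close>, of x1] disj[OF wx \<open>adj H x2 y2\<close>] True
            \<open>x1 = y1\<close> by simp
        ultimately show ?thesis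
          using True g(2)[OF wx] by (simp add: D1)
      qed
    next
      case False
      then have wx: "adj H w2 x2" "w1 = x1"
        using a(1) by (auto simp: adj_cart_prod)
      show ?thesis
      proof (cases "x2 = y2")
        case True
        then have "adj G x1 y1"
          using a(2) irr by (auto simp: adj_cart_prod)
        moreover have "y1 = z1" "z2 = w2"
          using a True wx \<open>adj G x1 y1\<close> irr by (auto simp: adj_cart_prod)
        moreover have "(vs @ ws) ! D w x \<noteq> (vs @ ws) ! D x y"
          using n2[OF wx(1), of x1] n1[OF \<open>adj G x1 y1\<close>, of x2] disj[OF \<open>adj G x1 y1\<close> wx(1)] True
            wx(2) by simp
        ultimately show ?thesis
          using True wx D2[OF wx(1)] D2[OF adj_sym[OF wx(1)]] h(2)[OF wx(1)] by simp
      next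
        case xy: False
        then have "x1 = y1" "adj H x2 y2"
          using a(2) by (auto simp: adj_cart_prod)
        moreover have "y1 = z1" "adj H y2 z2" "adj H z2 w2" "w2 \<noteq> y2" "x2 \<noteq> z2"
          using a irr wx \<open>x1 = y1\<close> by (auto simp: adj_cart_prod)
        ultimately show ?thesis
          using wx n2 h(6,7)[of w2 x2 y2 z2] by (simp add: D2)
      qed
    qed
  qed
qed

lemma labelling_cart_prods_Nil: "labelling n (cart_prods []) []"
  by (rule labellingI[of "\<lambda>_. 0" _ _ "\<lambda>_ _. 0"]) auto

lemma labelling_cart_prods_Cons:
  assumes "\<forall>G\<in>set (G # Gs). fin_simple_graph G" "labelling n G vs" "labelling n (cart_prods Gs) ws"
    and "set vs \<inter> set ws = {}"
  shows "labelling n (cart_prods (G # Gs)) (vs @ ws)"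
proof (rule labelling_lhom[OF graph_iso_lhom[OF _ graph_iso_sym[OF cart_prods_Cons]]])
  show "fin_simple_graph (cart_prods (G # Gs))"
    by (rule fin_simple_cart_prods[OF assms(1)])
  show "labelling n (G \<box> cart_prods Gs) (vs @ ws)"
    using assms by (intro labelling_cart_prod fin_simple_cart_prods) auto
qed

lemma labelling_path_2:
  assumes "v < 2 ^ n" shows "labelling n (path_graph 2) [v]"
  using assms by (intro labellingI[of "\<lambda>x. if odd x then v else 0" _ _ "\<lambda>_ _. 0"])
    (auto simp: adj_path_graph)

lemma adj_cycle_graph_linear:
  assumes "n \<ge> 2"
  shows "adj (cycle_graph n) i j \<longleftrightarrow>
    i < n \<and> j < n \<and> (j = Suc i \<or> i = Suc j \<or> i = 0 \<and> Suc j = n \<or> j = 0 \<and> Suc i = n)"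
  using assms by (auto simp: adj_cycle_graph mod_Suc)

lemma labelling_cycle:
  assumes "even N" "N \<ge> 6" "v < 2 ^ n" shows "labelling n (cycle_graph N) [v, v]"
proof -
  note adj = adj_cycle_graph_linear[of N]
  \<comment> \<open>The edge from i to i + 1 has direction i modulo 2. The closing edge joins 0 and
    N - 1, where the minimum would give 0, but alternation around an even cycle requires 1.\<close>
  let ?d = "\<lambda>x y :: nat. if x = 0 \<and> Suc y = N \<or> y = 0 \<and> Suc x = N then 1 else min x y mod 2"
  show ?thesis
  proof (rule labellingI[of "\<lambda>x. if odd x then v else 0" _ _ ?d])
    show "(if odd x then v else 0) < 2 ^ n" for x :: nat
      using assms(3) by simp
    fix x y assume a: "adj (cycle_graph N) x y"
    show "?d x y = ?d y x"
      by (auto simp: min.commute)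
    show d: "?d x y < length [v, v]"
      by (simp add: numeral_2_eq_2)
    have "odd x \<noteq> odd y"
      using a assms by (auto simp: adj)
    moreover have "[v, v] ! i = v" if "i < length [v, v]" for i
      using that by (auto simp: less_Suc_eq)
    from this[OF d] have "[v, v] ! ?d x y = v" .
    ultimately show "(if odd y then v else 0) = xor (if odd x then v else 0) ([v, v] ! ?d x y)"
      by simp
  next
    fix x y z assume "adj (cycle_graph N) x y" "adj (cycle_graph N) x z" "y \<noteq> z"
    moreover have "i mod 2 \<noteq> Suc i mod 2" "Suc i mod 2 \<noteq> i mod 2" for i :: nat
      by presburger+
    moreover have "(N - 2) mod 2 = 0"
      using assms by simp
    ultimately show "?d x y \<noteq> ?d x z"
      using assms by (auto simp: adj min_def split: if_splits)
  next
    fix w x y z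
    assume "adj (cycle_graph N) w x" "adj (cycle_graph N) x y" "adj (cycle_graph N) y z" "adj (cycle_graph N) z w"
      "w \<noteq> y" "x \<noteq> z"
    \<comment> \<open>A cycle of length at least 6 contains no 4-cycle; this is why both directions
      may carry the same vector.\<close>
    then have False
      using assms(2) by (simp add: adj) linarith
    then show "?d w x = ?d y z \<and> [v, v] ! ?d w x \<noteq> [v, v] ! ?d x y" ..
  qed
qed

text \<open>Row u and column i hold the color of the edge in direction i at a vertex labelled u. The
  innermost condition handles 4-cycles; it skips directions with equal vectors, since by
  \<open>labelling\<close> these never span one. Quantifying over the elements of lists keeps the
  check executable.\<close>

definition table_ok :: "nat \<Rightarrow> nat \<Rightarrow> nat list \<Rightarrow> nat list list \<Rightarrow> bool" where
  "table_ok n k vs T \<longleftrightarrow>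
    (\<forall>u\<in>set [0..<2 ^ n]. \<forall>i\<in>set [0..<length vs].
      T ! u ! i < k \<and> T ! xor u (vs ! i) ! i = T ! u ! i \<and>
      (\<forall>j\<in>set [0..<length vs]. i \<noteq> j \<longrightarrow> T ! u ! j \<noteq> T ! u ! i \<and>
        (vs ! j \<noteq> vs ! i \<longrightarrow> T ! xor u (vs ! j) ! i \<noteq> T ! u ! i)))"

lemma B_colorable_labelling:
  assumes "labelling n G vs" "table_ok n k vs T" shows "B_colorable G k"
proof -
  obtain L d where g: "\<And>u. L u < 2 ^ n"
    "\<And>u v. adj G u v \<Longrightarrow> d u v = d v u" "\<And>u v. adj G u v \<Longrightarrow> d u v < length vs"
    "\<And>u v. adj G u v \<Longrightarrow> L v = xor (L u) (vs ! d u v)"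
    "\<And>u v w. adj G u v \<Longrightarrow> adj G u w \<Longrightarrow> v \<noteq> w \<Longrightarrow> d u v \<noteq> d u w"
    "\<And>w x y z. adj G w x \<Longrightarrow> adj G x y \<Longrightarrow> adj G y z \<Longrightarrow> adj G z w \<Longrightarrow> w \<noteq> y \<Longrightarrow> x \<noteq> z \<Longrightarrow> d w x = d y z"
    "\<And>w x y z. adj G w x \<Longrightarrow> adj G x y \<Longrightarrow> adj G y z \<Longrightarrow> adj G z w \<Longrightarrow> w \<noteq> y \<Longrightarrow> x \<noteq> z \<Longrightarrow>
      vs ! d w x \<noteq> vs ! d x y"
    by (rule labellingE[OF assms(1)]) (rule that)
  have T: "T ! u ! i < k" "T ! xor u (vs ! i) ! i = T ! u ! i"
    if "u < 2 ^ n" "i < length vs" for u i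
    using assms(2) that unfolding table_ok_def by auto
  have T': "T ! u ! j \<noteq> T ! u ! i" "vs ! j \<noteq> vs ! i \<Longrightarrow> T ! xor u (vs ! j) ! i \<noteq> T ! u ! i"
    if "u < 2 ^ n" "i < length vs" "j < length vs" "i \<noteq> j" for u i j
    using assms(2) that unfolding table_ok_def by auto
  show ?thesis
  proof (rule B_colorableI[of _ "\<lambda>x y. T ! L x ! d x y"])
    fix x y assume a: "adj G x y"
    show "T ! L x ! d x y = T ! L y ! d y x"
      using T(2)[OF g(1) g(3)[OF a], of x] g(2,4)[OF a] by simp
    show "T ! L x ! d x y < k"
      by (rule T(1)[OF g(1) g(3)[OF a]])
  next
    fix x y z assume a: "adj G x y" "adj G x z" "y \<noteq> z"
    show "T ! L x ! d x y \<noteq> T ! L x ! d x z"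
      using T'(1)[OF g(1) g(3)[OF a(2)] g(3)[OF a(1)]] g(5)[OF a] by metis
  next
    fix w x y z
    assume a: "adj G w x" "adj G x y" "adj G y z" "adj G z w" "w \<noteq> y" "x \<noteq> z"
    \<comment> \<open>The labels of x and y differ by the vector of the direction
      \<open>d x y\<close>, which is not the vector of \<open>d w x\<close>.\<close>
    have "T ! L y ! d w x \<noteq> T ! L x ! d w x"
      using T'(2)[OF g(1) g(3)[OF a(1)] g(3)[OF a(2)] _ g(7)[OF a, symmetric], of x] g(7)[OF a] g(4)[OF a(2)]
      by metis
    moreover have "T ! L x ! d w x = T ! L w ! d w x"
      using T(2)[OF g(1) g(3)[OF a(1)], of w] g(4)[OF a(1)] by simp
    ultimately show "T ! L w ! d w x \<noteq> T ! L y ! d y z"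
      using g(6)[OF a] by simp
  qed
qed

section \<open>Building blocks\<close>

lemma cart_prods_path_2_path_2_cong:
  assumes "cart_prods Gs \<simeq> cart_prods Hs"
  shows "cart_prods (path_graph 2 # path_graph 2 # Gs) \<simeq> cart_prods (cycle_graph 4 # Hs)"
proof -
  have "cart_prods (path_graph 2 # path_graph 2 # Gs) \<simeq> path_graph 2 \<box> (path_graph 2 \<box> cart_prods Gs)"
    by (rule graph_iso_sym[OF graph_iso_trans[OF cart_prod_cong[OF graph_iso_refl cart_prods_Cons] cart_prods_Cons]])
  also have "\<dots> \<simeq> (path_graph 2 \<box> path_graph 2) \<box> cart_prods Gs"
    by (rule graph_iso_sym[OF cart_prod_assoc])
  also have "\<dots> \<simeq> cycle_graph 4 \<box> cart_prods Hs"
    by (rule cart_prod_cong[OF path_2_path_2_iso_cycle_4 assms])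
  also have "\<dots> \<simeq> cart_prods (cycle_graph 4 # Hs)"
    by (rule cart_prods_Cons)
  finally show ?thesis .
qed

lemma cart_prods_lhom:
  assumes "list_all2 (\<leadsto>) Gs Hs" "\<forall>G\<in>set Gs. fin_simple_graph G" "\<forall>H\<in>set Hs. fin_simple_graph H"
  shows "cart_prods Gs \<leadsto> cart_prods Hs"
  using assms
proof (induction Gs Hs rule: list_all2_induct)
  case Nil
  show ?case by (rule lhomI[of _ "\<lambda>_. []"]) auto
next
  case (Cons G Gs H Hs)
  have s: "fin_simple_graph (cart_prods (G # Gs))" "fin_simple_graph (cart_prods Hs)"
    "fin_simple_graph (H \<box> cart_prods Hs)" "fin_simple_graph H"
    using Cons.prems by (auto intro!: fin_simple_cart_prods fin_simple_cart_prod simp del: cart_prods.simps)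
  have "cart_prods (G # Gs) \<leadsto> G \<box> cart_prods Gs"
    by (rule graph_iso_lhom[OF s(1) graph_iso_sym[OF cart_prods_Cons]])
  also have "\<dots> \<leadsto> H \<box> cart_prods Hs"
    using Cons s by (intro lhom_cart_prod) auto
  also have "\<dots> \<leadsto> cart_prods (H # Hs)"
    by (rule graph_iso_lhom[OF s(3) cart_prods_Cons])
  finally show ?case .
qed

definition factor :: "'a graph \<Rightarrow> bool" where
  "factor G \<longleftrightarrow> fin_simple_graph G \<and> bipartite G \<and> verts G \<noteq> {}"

lemma factor_path_graph: "m \<ge> 1 \<Longrightarrow> factor (path_graph m)"
  by (auto simp: factor_def fin_simple_path_graph bipartite_path_graph lessThan_empty_iff bot_nat_def)

lemma factor_cycle_graph: "n \<ge> 2 \<Longrightarrow> factor (cycle_graph (2 * n))"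
  by (auto simp: factor_def fin_simple_cycle_graph bipartite_cycle_graph lessThan_empty_iff bot_nat_def)

lemma factor_cycle_graph_4: "factor (cycle_graph 4)"
  using factor_cycle_graph[of 2] by simp

lemmas factors = factor_path_graph factor_cycle_graph factor_cycle_graph_4

definition factors_colorable :: "'a graph list \<Rightarrow> nat \<Rightarrow> bool" where
  "factors_colorable Gs k \<longleftrightarrow> (\<forall>G\<in>set Gs. factor G) \<and> B_colorable (cart_prods Gs) k"

text \<open>For natural numbers \<open>even k \<or> k > 1\<close> means that k is not 1. This form
  is immediate for the palettes of size \<open>2 * l\<close>, possibly 0, that occur below.\<close>

lemma factors_colorable_combine:
  assumes "factors_colorable Gs k" "factors_colorable Hs l" "even k \<or> k > 1" "even l \<or> l > 1"
    and "mset Ks = mset Gs + mset Hs" "m = k + l"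
  shows "factors_colorable Ks m"
proof -
  have K: "mset Ks = mset (Gs @ Hs)"
    using assms(5) by simp
  then have "\<forall>G\<in>set Ks. factor G"
    using mset_eq_setD[OF K] assms(1,2) by (auto simp: factors_colorable_def)
  moreover have "B_colorable (cart_prods (Gs @ Hs)) (k + l)"
    using assms(1-4) by (intro B_colorable_cart_prods_append) (auto simp: factors_colorable_def factor_def)
  ultimately show ?thesis
    using B_colorable_iso[OF fin_simple_cart_prods cart_prods_mset_cong[OF K]] assms(6)
    by (simp add: factors_colorable_def factor_def)
qed

lemma factors_colorable_Nil: "factors_colorable [] 0"
  by (auto simp: factors_colorable_def B_colorable_def B_fun_def)

lemma factors_colorable_lhom:
  assumes "factors_colorable Hs k" "list_all2 (\<leadsto>) Gs Hs" "\<forall>G\<in>set Gs. factor G"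
  shows "factors_colorable Gs k"
  using assms B_colorable_lhom[OF cart_prods_lhom[OF assms(2)]]
  by (auto simp: factors_colorable_def factor_def)

lemma factors_colorable_iso:
  assumes "B_colorable (cart_prods Hs) k" "cart_prods Hs \<simeq> cart_prods Gs" "\<forall>G\<in>set Gs. factor G"
  shows "factors_colorable Gs k"
  using assms B_colorable_iso[OF fin_simple_cart_prods graph_iso_sym[OF assms(2)]]
  by (auto simp: factors_colorable_def factor_def)

section \<open>Blocks colored by explicit tables\<close>

lemmas labelling_intros = labelling_cart_prods_Cons labelling_cart_prods_Nil labelling_path_2 labelling_cycle

lemmas fin_simple_factors = fin_simple_path_graph fin_simple_cycle_graph

text \<open>One color more than the degree, as any 4-cycle forces four colors. The vectors are
  independent, so the table lists the colors at the eight vertices of the 3-dimensional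
  cube.\<close>

lemma colorable_path_2_C4: "factors_colorable [path_graph 2, cycle_graph 4] 4"
proof (rule factors_colorable_iso)
  have "labelling 3 (cart_prods [path_graph 2, path_graph 2, path_graph 2]) ([5] @ [6] @ [1] @ [])"
    by (intro labelling_intros) (auto simp: fin_simple_factors)
  then have "labelling 3 (cart_prods [path_graph 2, path_graph 2, path_graph 2]) [5, 6, 1]"
    by (simp only: append.simps)
  moreover have "table_ok 3 4 [5, 6, 1]
      [[0, 1, 2], [3, 0, 2], [1, 2, 0], [2, 3, 0], [3, 2, 1], [0, 3, 1], [2, 1, 3], [1, 0, 3]]"
    by code_simp
  ultimately show "B_colorable (cart_prods [path_graph 2, path_graph 2, path_graph 2]) 4"
    by (rule B_colorable_labelling)
  show "cart_prods [path_graph 2, path_graph 2, path_graph 2] \<simeq> cart_prods [path_graph 2, cycle_graph 4]"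
    by (intro cart_prods_path_2_path_2_cong cart_prods_Cons_cong graph_iso_refl)
qed (simp add: factors)

text \<open>The four vectors add up to zero and any three of them are independent, so the labels
  identify antipodal vertices of the 4-dimensional cube.\<close>

lemma colorable_C4_C4: "factors_colorable [cycle_graph 4, cycle_graph 4] 4"
proof (rule factors_colorable_iso)
  let ?Q = "[path_graph 2, path_graph 2, path_graph 2, path_graph 2]"
  have "labelling 3 (cart_prods ?Q) ([3] @ [7] @ [6] @ [2] @ [])"
    by (intro labelling_intros) (auto simp: fin_simple_factors)
  then have "labelling 3 (cart_prods ?Q) [3, 7, 6, 2]"
    by (simp only: append.simps)
  moreover have "table_ok 3 4 [3, 7, 6, 2]
      [[0, 1, 2, 3], [2, 3, 0, 1], [2, 0, 1, 3], [0, 2, 3, 1],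
       [3, 2, 1, 0], [1, 0, 3, 2], [1, 3, 2, 0], [3, 1, 0, 2]]"
    by code_simp
  ultimately show "B_colorable (cart_prods ?Q) 4"
    by (rule B_colorable_labelling)
  show "cart_prods ?Q \<simeq> cart_prods [cycle_graph 4, cycle_graph 4]"
    by (intro cart_prods_path_2_path_2_cong cart_prods_Cons_cong graph_iso_refl)
qed (simp add: factors)

text \<open>The vectors are all nonzero ones in dimension 3, and a label is a syndrome of the
  Hamming code of length 7. The table is a proper 7-coloring of the complete graph on the eight
  labels in which opposite edges of every affine plane, cut into two parallel pairs of points,
  differ.\<close>

lemma colorable_path_2_C4_C4_C4:
  "factors_colorable [path_graph 2, cycle_graph 4, cycle_graph 4, cycle_graph 4] 7"
proof (rule factors_colorable_iso)
  let ?Q = "[path_graph 2, path_graph 2, path_graph 2, path_graph 2, path_graph 2, path_graph 2, path_graph 2]"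
  have "labelling 3 (cart_prods ?Q) ([1] @ [2] @ [3] @ [4] @ [5] @ [6] @ [7] @ [])"
    by (intro labelling_intros) (auto simp: fin_simple_factors)
  then have "labelling 3 (cart_prods ?Q) [1, 2, 3, 4, 5, 6, 7]"
    by (simp only: append.simps)
  moreover have "table_ok 3 7 [1, 2, 3, 4, 5, 6, 7]
      [[0, 1, 2, 3, 4, 5, 6], [0, 5, 4, 6, 2, 3, 1], [6, 1, 4, 2, 5, 0, 3], [6, 5, 2, 0, 3, 1, 4],
       [5, 6, 1, 3, 2, 0, 4], [5, 2, 0, 6, 4, 1, 3], [4, 6, 0, 2, 3, 5, 1], [4, 2, 1, 0, 5, 3, 6]]"
    by code_simp
  ultimately show "B_colorable (cart_prods ?Q) 7"
    by (rule B_colorable_labelling)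
  show "cart_prods ?Q \<simeq> cart_prods [path_graph 2, cycle_graph 4, cycle_graph 4, cycle_graph 4]"
    by (intro cart_prods_path_2_path_2_cong cart_prods_Cons_cong graph_iso_refl)
qed (simp add: factors)

text \<open>Serves even numbers of 4-cycles: the block with three of them would leave an odd number.
  Nine distinct nonzero vectors in dimension 4 reduce 512 vertices to 16 rows.\<close>

lemma colorable_path_2_C4_C4_C4_C4:
  "factors_colorable [path_graph 2, cycle_graph 4, cycle_graph 4, cycle_graph 4, cycle_graph 4] 9"
proof (rule factors_colorable_iso)
  let ?Q = "[path_graph 2, path_graph 2, path_graph 2, path_graph 2, path_graph 2, path_graph 2,
    path_graph 2, path_graph 2, path_graph 2]"
  have "labelling 4 (cart_prods ?Q) ([7] @ [5] @ [10] @ [1] @ [14] @ [12] @ [4] @ [11] @ [15] @ [])"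
    by (intro labelling_intros) (auto simp: fin_simple_factors)
  then have "labelling 4 (cart_prods ?Q) [7, 5, 10, 1, 14, 12, 4, 11, 15]"
    by (simp only: append.simps)
  moreover have "table_ok 4 9 [7, 5, 10, 1, 14, 12, 4, 11, 15]
      [[0, 1, 2, 3, 4, 5, 6, 7, 8], [4, 7, 1, 3, 6, 0, 8, 5, 2], [5, 4, 3, 1, 6, 8, 2, 0, 7],
       [8, 6, 4, 1, 2, 3, 7, 5, 0], [8, 7, 0, 2, 3, 4, 6, 1, 5], [5, 1, 7, 2, 0, 6, 8, 3, 4],
       [4, 6, 7, 5, 0, 1, 2, 3, 8], [0, 4, 8, 5, 3, 2, 7, 1, 6], [2, 1, 3, 7, 0, 4, 8, 5, 6],
       [1, 2, 4, 7, 3, 6, 5, 0, 8], [6, 0, 2, 8, 3, 1, 7, 5, 4], [3, 6, 1, 8, 0, 2, 4, 7, 5],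
       [3, 2, 7, 4, 6, 5, 8, 1, 0], [6, 1, 8, 4, 2, 0, 5, 3, 7], [1, 6, 0, 5, 4, 8, 7, 3, 2],
       [2, 0, 7, 5, 6, 3, 4, 1, 8]]"
    by code_simp
  ultimately show "B_colorable (cart_prods ?Q) 9"
    by (rule B_colorable_labelling)
  show "cart_prods ?Q \<simeq> cart_prods [path_graph 2, cycle_graph 4, cycle_graph 4, cycle_graph 4, cycle_graph 4]"
    by (intro cart_prods_path_2_path_2_cong cart_prods_Cons_cong graph_iso_refl)
qed (simp add: factors)

text \<open>The repeated vector 14 belongs to the long cycle, along which the label only alternates;
  hence the table does not depend on n.\<close>

lemma colorable_path_2_C4_cycle:
  assumes "n \<ge> 3"
  shows "factors_colorable [path_graph 2, cycle_graph 4, cycle_graph (2 * n)] 5"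
proof (rule factors_colorable_iso)
  let ?Q = "[path_graph 2, path_graph 2, path_graph 2, cycle_graph (2 * n)]"
  have "labelling 4 (cart_prods ?Q) ([9] @ [1] @ [4] @ [14, 14] @ [])"
    using assms by (intro labelling_intros) (auto simp: fin_simple_factors)
  then have "labelling 4 (cart_prods ?Q) [9, 1, 4, 14, 14]"
    by (simp only: append.simps)
  moreover have "table_ok 4 5 [9, 1, 4, 14, 14]
      [[0, 1, 2, 3, 4], [2, 1, 4, 0, 3], [0, 1, 2, 4, 3], [2, 1, 4, 3, 0],
       [4, 0, 2, 1, 3], [1, 0, 4, 3, 2], [4, 0, 2, 3, 1], [1, 0, 4, 2, 3],
       [2, 4, 0, 3, 1], [0, 4, 1, 2, 3], [2, 4, 0, 1, 3], [0, 4, 1, 3, 2],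
       [1, 2, 0, 4, 3], [4, 2, 1, 3, 0], [1, 2, 0, 3, 4], [4, 2, 1, 0, 3]]"
    by code_simp
  ultimately show "B_colorable (cart_prods ?Q) 5"
    by (rule B_colorable_labelling)
  show "cart_prods ?Q \<simeq> cart_prods [path_graph 2, cycle_graph 4, cycle_graph (2 * n)]"
    by (intro cart_prods_path_2_path_2_cong cart_prods_Cons_cong graph_iso_refl)
qed (use assms in \<open>simp add: factors\<close>)

text \<open>For exactly two 4-cycles and at least two longer ones. All seven nonzero vectors in
  dimension 3 occur, and 3 and 5 are doubled for the long cycles.\<close>

lemma colorable_path_2_C4_C4_cycle_cycle:
  assumes "n \<ge> 3" "n' \<ge> 3"
  shows "factors_colorable
    [path_graph 2, cycle_graph 4, cycle_graph 4, cycle_graph (2 * n), cycle_graph (2 * n')] 9"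
proof (rule factors_colorable_iso)
  let ?Q = "[path_graph 2, path_graph 2, path_graph 2, path_graph 2, path_graph 2,
    cycle_graph (2 * n), cycle_graph (2 * n')]"
  have "labelling 3 (cart_prods ?Q) ([4] @ [1] @ [2] @ [7] @ [6] @ [3, 3] @ [5, 5] @ [])"
    using assms by (intro labelling_intros) (auto simp: fin_simple_factors)
  then have "labelling 3 (cart_prods ?Q) [4, 1, 2, 7, 6, 3, 3, 5, 5]"
    by (simp only: append.simps)
  moreover have "table_ok 3 9 [4, 1, 2, 7, 6, 3, 3, 5, 5]
      [[0, 1, 2, 3, 4, 5, 6, 7, 8], [4, 1, 7, 5, 6, 0, 8, 2, 3], [3, 4, 2, 6, 7, 0, 8, 5, 1],
       [2, 4, 7, 1, 3, 5, 6, 8, 0], [0, 5, 6, 1, 7, 8, 4, 2, 3], [4, 5, 0, 6, 3, 2, 1, 7, 8],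
       [3, 7, 6, 5, 4, 2, 1, 8, 0], [2, 7, 0, 3, 6, 8, 4, 5, 1]]"
    by code_simp
  ultimately show "B_colorable (cart_prods ?Q) 9"
    by (rule B_colorable_labelling)
  show "cart_prods ?Q \<simeq> cart_prods
      [path_graph 2, cycle_graph 4, cycle_graph 4, cycle_graph (2 * n), cycle_graph (2 * n')]"
    by (intro cart_prods_path_2_path_2_cong cart_prods_Cons_cong graph_iso_refl)
qed (use assms in \<open>simp add: factors\<close>)

lemma colorable_cycle:
  assumes "n \<ge> 3" shows "factors_colorable [cycle_graph (2 * n)] 2"
proof -
  have "labelling 1 (cart_prods [cycle_graph (2 * n)]) ([1, 1] @ [])"
    using assms by (intro labelling_intros) (auto simp: fin_simple_factors)
  then have "labelling 1 (cart_prods [cycle_graph (2 * n)]) [1, 1]"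
    by (simp only: append.simps)
  moreover have "table_ok 1 2 [1, 1] [[0, 1], [0, 1]]"
    by code_simp
  ultimately have "B_colorable (cart_prods [cycle_graph (2 * n)]) 2"
    by (rule B_colorable_labelling)
  then show ?thesis
    using assms by (simp add: factors_colorable_def factors)
qed

section \<open>Blocks obtained from the tables by pulling back\<close>

lemma path_lhom_long_cycle: "path_graph m \<leadsto> cycle_graph (2 * m + 6)"
  by (rule path_lhom_cycle) auto

text \<open>The half-length \<open>m + 3\<close> is at least 3, as the blocks with long cycles
  require, and its double is at least m, so the path embeds. It includes the edge, at the price of a
  second color.\<close>

lemma colorable_path: "m \<ge> 1 \<Longrightarrow> factors_colorable [path_graph m] 2"
  by (rule factors_colorable_lhom[OF colorable_cycle[of "m + 3"]])
    (auto simp: factors path_lhom_long_cycle)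

lemma colorable_C4_path: "m \<ge> 1 \<Longrightarrow> factors_colorable [cycle_graph 4, path_graph m] 4"
  by (rule factors_colorable_lhom[OF colorable_C4_C4]) (auto simp: factors path_lhom_cycle_4 lhom_refl)

lemma colorable_path_2_C4_path: "m \<ge> 1 \<Longrightarrow> factors_colorable [path_graph 2, cycle_graph 4, path_graph m] 5"
  by (rule factors_colorable_lhom[OF colorable_path_2_C4_cycle[of "m + 3"]])
    (auto simp: factors path_lhom_long_cycle lhom_refl)

lemma colorable_path_2_path_path:
  "m \<ge> 1 \<Longrightarrow> m' \<ge> 1 \<Longrightarrow> factors_colorable [path_graph 2, path_graph m, path_graph m'] 5"
  by (rule factors_colorable_lhom[OF colorable_path_2_C4_path[of m']])
    (auto simp: factors path_lhom_cycle_4 lhom_refl)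

lemma colorable_path_2_path_C4_C4:
  "m \<ge> 1 \<Longrightarrow> factors_colorable [path_graph 2, path_graph m, cycle_graph 4, cycle_graph 4] 7"
  by (rule factors_colorable_lhom[OF colorable_path_2_C4_C4_C4])
    (auto simp: factors path_lhom_cycle_4 lhom_refl)

text \<open>Even n makes the length divisible by 4, so the cycle can take the place of a third
  4-cycle.\<close>

lemma colorable_path_2_cycle_C4_C4:
  assumes "even n" "n \<ge> 2"
  shows "factors_colorable [path_graph 2, cycle_graph (2 * n), cycle_graph 4, cycle_graph 4] 7"
proof (rule factors_colorable_lhom[OF colorable_path_2_C4_C4_C4])
  have "cycle_graph (2 * n) \<leadsto> cycle_graph 4"
    using assms by (intro cycle_lhom_cycle_4) auto
  then show "list_all2 (\<leadsto>) [path_graph 2, cycle_graph (2 * n), cycle_graph 4, cycle_graph 4]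
      [path_graph 2, cycle_graph 4, cycle_graph 4, cycle_graph 4]"
    by (simp add: lhom_refl)
qed (use assms in \<open>simp add: factors\<close>)

section \<open>Upper bounds\<close>

lemma colorable_C4s: "even a \<Longrightarrow> factors_colorable (replicate a (cycle_graph 4)) (2 * a)"
proof (induction a rule: less_induct)
  case (less a)
  show ?case
  proof (cases "a = 0")
    case True
    then show ?thesis by (simp add: factors_colorable_Nil)
  next
    case False
    then have "a = Suc (Suc (a - 2)) \<and> even (a - 2)"
      using less.prems by presburger
    then obtain b where b: "a = Suc (Suc b)" "even b"
      by blast
    show ?thesis
      by (rule factors_colorable_combine[OF colorable_C4_C4 less.IH[of b]]) (auto simp: b)
  qed
qed

lemma colorable_cycles:
  "\<forall>n\<in>set ns. n \<ge> 3 \<Longrightarrow> factors_colorable (map (\<lambda>n. cycle_graph (2 * n)) ns) (2 * length ns)"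
proof (induction ns)
  case Nil
  show ?case by (simp add: factors_colorable_Nil)
next
  case (Cons n ns)
  show ?case
    by (rule factors_colorable_combine[OF colorable_cycle[of n] Cons.IH]) (use Cons.prems in auto)
qed

lemma colorable_paths:
  "\<forall>m\<in>set ms. m \<ge> 3 \<Longrightarrow> factors_colorable (map path_graph ms) (2 * length ms)"
proof (induction ms)
  case Nil
  show ?case by (simp add: factors_colorable_Nil)
next
  case (Cons m ms)
  show ?case
    by (rule factors_colorable_combine[OF colorable_path[of m] Cons.IH]) (use Cons.prems in auto)
qed

text \<open>The 4-cycles are merely counted, since parity and size of their number govern the choice
  of blocks; \<open>ns\<close> is meant for half-lengths at least 3.\<close>

abbreviation family :: "nat list \<Rightarrow> nat \<Rightarrow> nat list \<Rightarrow> nat graph list" where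
  "family ms a ns \<equiv> map path_graph ms @ replicate a (cycle_graph 4) @ map (\<lambda>n. cycle_graph (2 * n)) ns"

lemma colorable_family_even:
  assumes "\<forall>m\<in>set ms. m \<ge> 3" "\<forall>n\<in>set ns. n \<ge> 3" "even a"
  shows "factors_colorable (family ms a ns) (2 * (length ms + a + length ns))"
proof -
  have "factors_colorable (replicate a (cycle_graph 4) @ map (\<lambda>n. cycle_graph (2 * n)) ns) (2 * (a + length ns))"
    by (rule factors_colorable_combine[OF colorable_C4s[OF assms(3)] colorable_cycles[OF assms(2)]]) auto
  then show ?thesis
    by (rule factors_colorable_combine[OF colorable_paths[OF assms(1)]]) auto
qed

text \<open>If the number of 4-cycles is odd, a path serves as partner of the one left over.\<close>

lemma colorable_family:
  assumes "\<forall>m\<in>set ms. m \<ge> 3" "\<forall>n\<in>set ns. n \<ge> 3" "even a \<or> ms \<noteq> []"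
  shows "factors_colorable (family ms a ns) (2 * (length ms + a + length ns))"
proof (cases "even a")
  case False
  obtain m ms' where "ms = m # ms'"
    using False assms(3) by (cases ms) auto
  moreover obtain b where "a = Suc b" "even b"
    using False by (cases a) auto
  ultimately have b: "a = Suc b" "even b" "ms = m # ms'"
    by blast+
  show ?thesis
    by (rule factors_colorable_combine[OF colorable_C4_path[of m] colorable_family_even[of ms' ns b]])
      (use assms b in auto)
qed (use assms colorable_family_even in blast)

text \<open>One color is wasted: either the edge is treated as a path with two colors, or, if an odd
  4-cycle finds no path, it forms a 4-colored block with the edge.\<close>

lemma colorable_path_2_family_upper:
  assumes "\<forall>m\<in>set ms. m \<ge> 3" "\<forall>n\<in>set ns. n \<ge> 3"
  shows "factors_colorable (path_graph 2 # family ms a ns) (2 + 2 * (length ms + a + length ns))"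
proof (cases "even a \<or> ms \<noteq> []")
  case True
  show ?thesis
    by (rule factors_colorable_combine[OF colorable_path[of 2] colorable_family[OF assms True]]) auto
next
  case False
  then obtain b where b: "a = Suc b" "even b" "ms = []"
    by (cases a) auto
  show ?thesis
    by (rule factors_colorable_combine[OF colorable_path_2_C4 colorable_family_even[of ms ns b]])
      (use assms b in auto)
qed

text \<open>The edge joins a block of odd degree chosen so that the remaining 4-cycles are even in
  number. The assumptions \<open>c\<close> and \<open>c'\<close> remove the products in which none
  of the blocks above can be chosen in this way.\<close>

lemma colorable_path_2_family:
  assumes ms: "\<forall>m\<in>set ms. m \<ge> 3" and ns: "\<forall>n\<in>set ns. n \<ge> 3"
    and c: "ms = [] \<Longrightarrow> a \<ge> 1 \<and> a + length ns \<ge> 2 \<and> (a, ns) \<noteq> (2, []) \<and> (\<forall>n. odd n \<longrightarrow> (a, ns) \<noteq> (2, [n]))"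
    and c': "length ms = 1 \<Longrightarrow> a \<ge> 1"
  shows "factors_colorable (path_graph 2 # family ms a ns) (1 + 2 * (length ms + a + length ns))"
proof -
  consider "ms = []" | m where "ms = [m]" | m m' ms' where "ms = m # m' # ms'"
    by (cases ms; cases "tl ms") auto
  then show ?thesis
  proof cases
    case [simp]: 1
    \<comment> \<open>Without paths, the edge takes one, two, three or four 4-cycles. With one it
      also needs a long cycle, with two it needs a cycle of length divisible by 4 or two long
      cycles; with three or four nothing else.\<close>
    consider "a = 1" | "a = 2" | "odd a" "a \<ge> 3" | "even a" "a \<ge> 4"
    proof -
      have "a \<ge> 1"
        using c by simp
      then have "a = 1 \<or> a = 2 \<or> odd a \<and> a \<ge> 3 \<or> even a \<and> a \<ge> 4"
        by presburger
      then show thesis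
        using that by blast
    qed
    then show ?thesis
    proof cases
      case [simp]: 1
      obtain n ns' where [simp]: "ns = n # ns'"
        using c by (cases ns) auto
      show ?thesis
        by (rule factors_colorable_combine[OF colorable_path_2_C4_cycle[of n] colorable_family_even[of "[]" ns' 0]])
          (use ns in auto)
    next
      case 2
      then have [simp]: "a = Suc (Suc 0)"
        by simp
      obtain n ns' where [simp]: "ns = n # ns'"
        using c by (cases ns) auto
      show ?thesis
      proof (cases ns')
        case [simp]: Nil
        have "even n"
          using c 2 by auto
        then show ?thesis
          by (intro factors_colorable_combine[OF colorable_path_2_cycle_C4_C4[of n] factors_colorable_Nil])
            (use ns in auto)
      next
        case [simp]: (Cons n' ns'')
        show ?thesis
          by (rule factors_colorable_combine[OF colorable_path_2_C4_C4_cycle_cycle[of n n']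
                colorable_family_even[of "[]" ns'' 0]])
            (use ns in auto)
      qed
    next
      case 3
      then have "a = Suc (Suc (Suc (a - 3))) \<and> even (a - 3)"
        by presburger
      then obtain b where [simp]: "a = Suc (Suc (Suc b))" and "even b"
        by blast
      then show ?thesis
        by (intro factors_colorable_combine[OF colorable_path_2_C4_C4_C4 colorable_family_even[of "[]" ns b]])
          (use ns in auto)
    next
      case 4
      then have "a = Suc (Suc (Suc (Suc (a - 4)))) \<and> even (a - 4)"
        by presburger
      then obtain b where [simp]: "a = Suc (Suc (Suc (Suc b)))" and "even b"
        by blast
      then show ?thesis
        by (intro factors_colorable_combine[OF colorable_path_2_C4_C4_C4_C4 colorable_family_even[of "[]" ns b]])
          (use ns in auto)
    qed
  next
    case [simp]: (2 m)
    show ?thesis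
    proof (cases "even a")
      case True
      \<comment> \<open>An even \<open>a\<close> is at least 2 by \<open>c'\<close>. Taking two
        4-cycles into the block preserves the parity of the rest; an odd \<open>a\<close> gives away
        just one.\<close>
      then have "a = Suc (Suc (a - 2)) \<and> even (a - 2)"
        using c' by simp presburger
      then obtain b where [simp]: "a = Suc (Suc b)" and "even b"
        by blast
      then show ?thesis
        by (intro factors_colorable_combine[OF colorable_path_2_path_C4_C4[of m] colorable_family_even[of "[]" ns b]])
          (use ms ns in auto)
    next
      case False
      then obtain b where [simp]: "a = Suc b" and "even b"
        by (cases a) auto
      then show ?thesis
        by (intro factors_colorable_combine[OF colorable_path_2_C4_path[of m] colorable_family_even[of "[]" ns b]])
          (use ms ns in auto)
    qed
  next
    case [simp]: (3 m m' ms')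
    show ?thesis
    proof (cases "even a")
      case True
      then show ?thesis
        by (intro factors_colorable_combine[OF colorable_path_2_path_path[of m m'] colorable_family_even[of ms' ns a]])
          (use ms ns in auto)
    next
      case False
      then obtain b where [simp]: "a = Suc b" and "even b"
        by (cases a) auto
      then show ?thesis
        by (intro factors_colorable_combine[OF colorable_path_2_C4_path[of m] colorable_family_even[of "m' # ms'" ns b]])
          (use ms ns in auto)
    qed
  qed
qed

section \<open>The cube of dimension 5\<close>

datatype dir = X0 | X1 | X2 | X3 | X4

text \<open>The permutation at a vertex: position i holds the color of the edge in direction i,
  where colors are renamed to directions.\<close>

datatype row = Row dir dir dir dir dir

text \<open>There is no clause for \<open>X4\<close>, because the search stays within the face
  spanned by the other four directions. The colors at its vertices still include that of the edge
  leaving the face.\<close>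

fun agrees :: "dir \<Rightarrow> row \<Rightarrow> row \<Rightarrow> bool" where
  "agrees X0 (Row a b c d e) (Row a' b' c' d' e') \<longleftrightarrow>
    a = a' \<and> b \<noteq> b' \<and> c \<noteq> c' \<and> d \<noteq> d' \<and> e \<noteq> e'"
| "agrees X1 (Row a b c d e) (Row a' b' c' d' e') \<longleftrightarrow>
    b = b' \<and> a \<noteq> a' \<and> c \<noteq> c' \<and> d \<noteq> d' \<and> e \<noteq> e'"
| "agrees X2 (Row a b c d e) (Row a' b' c' d' e') \<longleftrightarrow>
    c = c' \<and> a \<noteq> a' \<and> b \<noteq> b' \<and> d \<noteq> d' \<and> e \<noteq> e'"
| "agrees X3 (Row a b c d e) (Row a' b' c' d' e') \<longleftrightarrow>
    d = d' \<and> a \<noteq> a' \<and> b \<noteq> b' \<and> c \<noteq> c' \<and> e \<noteq> e'"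

text \<open>The nine derangements of the other four entries.\<close>

fun cands :: "dir \<Rightarrow> row \<Rightarrow> row list" where
  "cands X0 (Row a b c d e) =
    [Row a c b e d, Row a c d e b, Row a c e b d,
     Row a d b e c, Row a d e b c, Row a d e c b,
     Row a e b c d, Row a e d b c, Row a e d c b]"
| "cands X1 (Row a b c d e) =
    [Row c b a e d, Row c b d e a, Row c b e a d,
     Row d b a e c, Row d b e a c, Row d b e c a,
     Row e b a c d, Row e b d a c, Row e b d c a]"
| "cands X2 (Row a b c d e) =
    [Row b a c e d, Row b d c e a, Row b e c a d,
     Row d a c e b, Row d e c a b, Row d e c b a,
     Row e a c b d, Row e d c a b, Row e d c b a]"
| "cands X3 (Row a b c d e) =
    [Row b a e d c, Row b c e d a, Row b e a d c,
     Row c a e d b, Row c e a d b, Row c e b d a,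
     Row e a b d c, Row e c a d b, Row e c b d a]"

fun offset :: "dir \<Rightarrow> nat" where
  "offset X0 = 0" | "offset X1 = 1" | "offset X2 = 3" | "offset X3 = 7"

text \<open>The vertices of the cube are numbered in binary. The second argument of the search holds the rows
  of the earlier vertices, latest first, so that the neighbor in direction i, whose number is
  smaller by a power of two, is found at position offset i. The first argument lists, for each
  remaining vertex, its directions towards earlier vertices.\<close>

fun search :: "dir list list \<Rightarrow> row list \<Rightarrow> bool" where
  "search [] ps \<longleftrightarrow> True"
| "search ([] # iss) ps \<longleftrightarrow> True"
| "search ((i # js) # iss) ps \<longleftrightarrow>
    list_ex (\<lambda>r. if list_all (\<lambda>j. agrees j (ps ! offset j) r) js then search iss (r # ps) else False)
      (cands i (ps ! offset i))"

text \<open>The entries are the nonzero binary digits of the vertices 1 to 15, highest first. In the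
  search the first direction generates the candidates and the others filter them.\<close>

definition lower_dirs :: "dir list list" where
  "lower_dirs =
     [[X0], [X1], [X1, X0], [X2], [X2, X0], [X2, X1], [X2, X1, X0],
      [X3], [X3, X0], [X3, X1],
      [X3, X1, X0], [X3, X2], [X3, X2, X0], [X3, X2, X1], [X3, X2, X1, X0]]"

text \<open>The seed is vertex 0, whose row becomes the identity after renaming the colors.\<close>

lemma search_fails: "\<not> search lower_dirs [Row X0 X1 X2 X3 X4]"
  by code_simp

section \<open>Numbering of the cube and completeness of the search\<close>

primrec idx :: "dir \<Rightarrow> nat" where
  "idx X0 = 0" | "idx X1 = 1" | "idx X2 = 2" | "idx X3 = 3" | "idx X4 = 4"

lemma inj_idx: "idx i = idx j \<longleftrightarrow> i = j"
  by (cases i; cases j) simp_all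

lemma idx_less: "idx i < 5"
  by (cases i) simp_all

definition flip :: "dir \<Rightarrow> nat \<Rightarrow> nat" where
  "flip i x = xor x (2 ^ idx i)"

lemma lower_dirs_flip:
  "\<forall>l\<in>set [0..<length lower_dirs]. \<forall>i\<in>set (lower_dirs ! l).
    i \<noteq> X4 \<and> offset i \<le> l \<and> flip i (l - offset i) = Suc l"
  by code_simp

lemma UNIV_dir: "UNIV = {X0, X1, X2, X3, X4}"
  using dir.exhaust by blast

lemma finite_dir: "finite (A :: dir set)"
  by (rule finite_subset[OF subset_UNIV]) (simp add: UNIV_dir)

lemma card_dir: "card (UNIV :: dir set) = 5"
  by (simp add: UNIV_dir)

lemma distinct_dirs_exhaust:
  assumes "distinct [a, b, c, d, e]" shows "x = a \<or> x = b \<or> x = c \<or> x = d \<or> x = (e :: dir)"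
proof -
  have "card {a, b, c, d, e} = card (UNIV :: dir set)"
    using assms by (simp add: card_dir)
  then have "{a, b, c, d, e} = UNIV"
    by (intro card_subset_eq finite_dir) auto
  then show ?thesis by blast
qed

lemma cands_complete:
  assumes p: "distinct [a, b, c, d, e]" and r: "distinct [a', b', c', d', e']"
    and "agrees i (Row a b c d e) (Row a' b' c' d' e')" "i \<noteq> X4"
  shows "Row a' b' c' d' e' \<in> set (cands i (Row a b c d e))"
proof -
  note ex = distinct_dirs_exhaust[OF p]
  show ?thesis
    using ex[of a'] ex[of b'] ex[of c'] ex[of d'] ex[of e'] assms
    by (cases i) (simp; elim disjE; simp)+
qed

text \<open>If a consistent assignment \<open>S\<close> exists, then at every vertex its own row is
  among the candidates and passes the filter, so one branch of the search follows \<open>S\<close>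
  to the end. The rows of the first k vertices are already placed.\<close>

lemma search_complete:
  assumes "\<And>l i. l < length iss \<Longrightarrow> i \<in> set (iss ! l) \<Longrightarrow> offset i < k + l"
    and "\<And>l i. l < length iss \<Longrightarrow> i \<in> set (iss ! l) \<Longrightarrow> agrees i (S (k + l - Suc (offset i))) (S (k + l))"
    and "\<And>l i. l < length iss \<Longrightarrow> i \<in> set (iss ! l) \<Longrightarrow> S (k + l) \<in> set (cands i (S (k + l - Suc (offset i))))"
  shows "search iss (rev (map S [0..<k]))"
  using assms
proof (induction iss arbitrary: k)
  case Nil
  show ?case by simp
next
  case (Cons ds iss)
  have nth: "rev (map S [0..<k]) ! offset i = S (k - Suc (offset i))" if "i \<in> set ds" for i
    using Cons.prems(1)[of 0 i] that by (simp add: rev_nth)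
  have a: "agrees i (S (k - Suc (offset i))) (S k)" "S k \<in> set (cands i (S (k - Suc (offset i))))"
    if "i \<in> set ds" for i
    using Cons.prems(2,3)[of 0 i] that by simp_all
  have "search iss (rev (map S [0..<Suc k]))"
  proof (rule Cons.IH)
    fix l i assume "l < length iss" "i \<in> set (iss ! l)"
    then show "offset i < Suc k + l" "agrees i (S (Suc k + l - Suc (offset i))) (S (Suc k + l))"
      "S (Suc k + l) \<in> set (cands i (S (Suc k + l - Suc (offset i))))"
      using Cons.prems[of "Suc l" i] by simp_all
  qed
  then have rec: "search iss (S k # rev (map S [0..<k]))"
    by simp
  show ?case
  proof (cases ds)
    case (Cons i js)
    then show ?thesis
      using a nth rec by (auto simp: list_ex_iff list_all_iff intro!: bexI[of _ "S k"])
  qed simp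
qed

text \<open>Only the five lowest bits are read, so numbers of vertices need no upper bound.\<close>

definition cube_vertex :: "nat \<Rightarrow> nat list" where
  "cube_vertex x = map (\<lambda>i. of_bool (bit x i)) [0..<5]"

lemma bit_flip: "bit (flip i x) j \<longleftrightarrow> (bit x j \<noteq> (j = idx i))"
  by (auto simp: flip_def bit_xor_iff bit_exp_iff possible_bit_def)

lemma flip_flip: "flip i (flip i x) = x"
  by (simp add: flip_def xor.assoc)

lemma flip_commute: "flip i (flip j x) = flip j (flip i x)"
  by (simp add: flip_def xor.assoc xor.commute xor.left_commute)

lemma cube_vertex_flip: "cube_vertex (flip i x) = (cube_vertex x)[idx i := 1 - cube_vertex x ! idx i]"
  using idx_less[of i] by (intro nth_equalityI) (auto simp: cube_vertex_def bit_flip nth_list_update)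

lemma cube_vertex_neq: "j < 5 \<Longrightarrow> bit x j \<noteq> bit y j \<Longrightarrow> cube_vertex x \<noteq> cube_vertex y"
  by (auto simp: cube_vertex_def list_eq_iff_nth_eq)

lemma verts_cube: "verts (cart_prods (replicate n (path_graph 2))) = {xs. length xs = n \<and> (\<forall>x\<in>set xs. x < 2)}"
proof (induction n)
  case (Suc n)
  then show ?case
    by (auto simp: verts_cart_prods_Cons length_Suc_conv image_iff simp del: cart_prods.simps)
qed auto

lemma adj_cube:
  assumes "length xs = n" "\<forall>x\<in>set xs. x < 2" "i < n"
  shows "adj (cart_prods (replicate n (path_graph 2))) xs (xs[i := 1 - xs ! i])"
  using assms
proof (induction n arbitrary: xs i)
  case (Suc n)
  then obtain y ys where xs: "xs = y # ys"
    by (cases xs) auto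
  show ?case
  proof (cases i)
    case 0
    then show ?thesis
      using Suc.prems
      by (auto simp: xs adj_cart_prods_Cons adj_cart_prod verts_cube adj_path_graph less_2_cases_iff
          simp del: cart_prods.simps)
  next
    case (Suc j)
    have a: "adj (cart_prods (replicate n (path_graph 2))) ys (ys[j := 1 - ys ! j])"
      using Suc.IH Suc.prems Suc by (simp add: xs)
    have "fin_simple_graph (cart_prods (replicate n (path_graph 2)))"
      by (intro fin_simple_cart_prods) (simp add: fin_simple_path_graph)
    from adj_verts[OF this a] a show ?thesis
      using Suc.prems Suc by (simp add: xs adj_cart_prods_Cons adj_cart_prod del: cart_prods.simps)
  qed
qed simp

text \<open>In a 5-coloring every color occurs at every vertex, so each vertex carries a permutation of
  the five directions, and permutations of adjacent vertices agree exactly in the direction of the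
  edge. No such assignment exists already on the 16 vertices of a 4-dimensional face.\<close>

lemma not_B_colorable_cube_5: "\<not> B_colorable (cart_prods (replicate 5 (path_graph 2))) 5"
proof
  let ?G = "cart_prods (replicate 5 (path_graph 2))"
  assume "B_colorable ?G 5"
  then obtain f where f: "B_fun ?G 5 f"
    by (rule B_colorableE)
  let ?v = cube_vertex
  define D where "D x i = f (?v x) (?v (flip i x))" for x i
  have adj: "adj ?G (?v x) (?v (flip i x))" for x i
    unfolding cube_vertex_flip by (rule adj_cube) (auto simp: cube_vertex_def idx_less)
  have ne1: "?v (flip i x) \<noteq> ?v (flip j x)" if "i \<noteq> j" for i j x
    by (rule cube_vertex_neq[OF idx_less[of i]]) (use that in \<open>simp add: bit_flip inj_idx\<close>)
  have ne2: "?v x \<noteq> ?v (flip i (flip j x))" if "i \<noteq> j" for i j x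
    by (rule cube_vertex_neq[OF idx_less[of i]]) (use that in \<open>simp add: bit_flip inj_idx\<close>)
  have D_less: "D x i < 5" for x i
    unfolding D_def by (rule B_funD(2)[OF f adj])
  have D_inj: "inj (D x)" for x
  proof (rule injI, rule ccontr)
    fix i j assume "D x i = D x j" "i \<noteq> j"
    with B_funD(3)[OF f adj adj ne1[OF \<open>i \<noteq> j\<close>]] show False
      by (simp add: D_def)
  qed
  have D_eq: "D (flip i x) i = D x i" for x i
    unfolding D_def flip_flip by (rule B_funD(1)[OF f adj, symmetric])
  have D_neq: "D (flip i x) j \<noteq> D x j" if "i \<noteq> j" for x i j
  proof -
    have "f (?v x) (?v (flip j x)) \<noteq> f (?v (flip i (flip j x))) (?v (flip i x))"
    proof (rule B_funD(4)[OF f adj adj])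
      show "adj ?G (?v (flip i (flip j x))) (?v (flip i x))"
        using adj_sym[OF adj[of "flip i x" j]] by (simp add: flip_commute)
      show "adj ?G (?v (flip i x)) (?v x)"
        by (rule adj_sym[OF adj])
    qed (use ne1[of j i] ne2 that in auto)
    moreover have "f (?v (flip i (flip j x))) (?v (flip i x)) = D (flip i x) j"
      unfolding D_def using B_funD(1)[OF f adj[of "flip i x" j]] by (simp add: flip_commute)
    ultimately show ?thesis
      unfolding D_def[of x] by simp
  qed
  \<comment> \<open>Five distinct colors below 5 exhaust the palette.\<close>
  have range: "range (D 0) = {..<5}"
    using D_less by (intro card_subset_eq) (auto simp: card_image[OF D_inj] card_dir)
  \<comment> \<open>Each color is renamed to the direction in which it occurs at vertex 0.\<close>
  define E where "E x i = inv (D 0) (D x i)" for x i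
  have inj: "inj_on (inv (D 0)) (range (D 0))"
    by (rule inj_on_inv_into) simp
  have E_iff: "E x i = E y j \<longleftrightarrow> D x i = D y j" for x y i j
    unfolding E_def by (rule inj_on_eq_iff[OF inj]) (simp_all add: range D_less)
  have E_0: "E 0 i = i" for i
    unfolding E_def by (rule inv_f_f[OF D_inj])
  define S where "S x = Row (E x X0) (E x X1) (E x X2) (E x X3) (E x X4)" for x
  have agrees: "agrees i (S x) (S (flip i x))" if "i \<noteq> X4" for i x
    using that by (cases i) (simp_all add: S_def E_iff D_eq D_neq D_neq[symmetric])
  have "S (flip i x) \<in> set (cands i (S x))" if "i \<noteq> X4" for i x
    using agrees[OF that, of x] that unfolding S_def
    by (rule cands_complete[rotated 2]) (auto simp: E_iff inj_eq[OF D_inj])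
  moreover have "offset i < 1 + l" "i \<noteq> X4" "S (1 + l) = S (flip i (1 + l - Suc (offset i)))"
    if "l < length lower_dirs" "i \<in> set (lower_dirs ! l)" for l i
    using lower_dirs_flip that by (auto simp: less_Suc_eq_le)
  ultimately have "search lower_dirs (rev (map S [0..<1]))"
    using agrees by (intro search_complete) metis+
  then show False
    using search_fails by (simp add: S_def E_0)
qed

section \<open>The B-coloring number\<close>

lemma cart_prods_single: "cart_prods [G] \<simeq> G"
  by (rule graph_iso_trans[OF graph_iso_sym[OF cart_prods_Cons]
        graph_iso_trans[OF cart_prod_commute cart_prod_Nil]])

lemma cart_prods_Cons_iso: "cart_prods Gs \<simeq> H \<Longrightarrow> cart_prods (G # Gs) \<simeq> G \<box> H"
  by (rule graph_iso_trans[OF graph_iso_sym[OF cart_prods_Cons] cart_prod_cong[OF graph_iso_refl]])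

lemma prod_list_ge:
  assumes "\<forall>m\<in>set ms. m \<ge> (k :: nat)" "ms \<noteq> []" "k \<ge> 1" shows "prod_list ms \<ge> k"
  using assms
proof (induction ms)
  case (Cons m ms)
  have "prod_list ms \<ge> 1"
    using Cons by (cases "ms = []") auto
  then have "k * 1 \<le> m * prod_list ms"
    using Cons.prems by (intro mult_mono) auto
  then show ?case by simp
qed simp

text \<open>Counting vertices suffices: a product of numbers that are at least 3 does not divide 2
  unless it is empty.\<close>

lemma path_2_product_iff:
  assumes "r \<le> 1" "\<forall>m\<in>set ms. m \<ge> 3"
  shows "cart_prods (replicate r (path_graph 2) @ map path_graph ms) \<simeq> path_graph 2 \<longleftrightarrow> r = 1 \<and> ms = []"
proof
  assume "cart_prods (replicate r (path_graph 2) @ map path_graph ms) \<simeq> path_graph 2"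
  from card_verts_iso[OF this] have c: "2 ^ r * prod_list ms = 2"
    by (simp add: card_verts_cart_prods comp_def prod_list_replicate)
  have "ms = []"
  proof (rule ccontr)
    assume "ms \<noteq> []"
    then have "3 \<le> prod_list ms"
      using prod_list_ge[OF assms(2)] by simp
    also have "\<dots> \<le> 2 ^ r * prod_list ms"
      by simp
    finally show False
      using c by simp
  qed
  then show "r = 1 \<and> ms = []"
    using c assms(1) by (cases r) auto
next
  assume "r = 1 \<and> ms = []"
  then show "cart_prods (replicate r (path_graph 2) @ map path_graph ms) \<simeq> path_graph 2"
    using cart_prods_single[of "path_graph 2"] by simp
qed

text \<open>The maximum degree determines the number of factors; then 16 vertices force the product
  of the two half-lengths to be 4.\<close>

lemma C4_C4_product:
  assumes "\<forall>n\<in>set ns. n \<ge> 2"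
    and "cart_prods (map (\<lambda>n. cycle_graph (2 * n)) ns) \<simeq> cycle_graph 4 \<box> cycle_graph 4"
  shows "ns = [2, 2]"
proof -
  let ?Es = "map (\<lambda>n. cycle_graph (2 * n)) ns"
  have f: "\<forall>G\<in>set ?Es. fin_simple_graph G \<and> verts G \<noteq> {}"
    using assms(1) factor_cycle_graph by (auto simp: factor_def)
  have "max_degree (cart_prods ?Es) = sum_list (map max_degree ?Es)"
    by (rule max_degree_cart_prods[OF f])
  also have "map max_degree ?Es = map (\<lambda>_. 2) ns"
    using assms(1) by (auto simp: max_degree_cycle_graph)
  also have "sum_list \<dots> = 2 * length ns"
    by (simp add: sum_list_triv)
  finally have "max_degree (cart_prods ?Es) = 2 * length ns" .
  moreover have "max_degree (cart_prods ?Es) = max_degree (cycle_graph 4 \<box> cycle_graph 4)"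
    using f by (intro max_degree_iso[OF _ _ assms(2)] fin_simple_cart_prods fin_simple_cart_prod)
      (auto simp: fin_simple_cycle_graph)
  moreover have "max_degree (cycle_graph 4 \<box> cycle_graph 4) = 4"
    using factor_cycle_graph_4 by (simp add: max_degree_cart_prod max_degree_cycle_graph factor_def)
  ultimately have "length ns = 2"
    by simp
  then obtain n n' where ns: "ns = [n, n']"
    by (auto simp: numeral_2_eq_2 length_Suc_conv)
  have "n * n' = 4"
    using card_verts_iso[OF assms(2)] unfolding card_verts_cart_prods ns
    by (simp add: card_cartesian_product mult.commute)
  moreover have "n \<ge> 2" "n' \<ge> 2"
    using assms(1) by (auto simp: ns)
  moreover have "n \<le> 2"
  proof (rule ccontr)
    assume "\<not> n \<le> 2"
    then have "3 * 2 \<le> n * n'"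
      using \<open>n' \<ge> 2\<close> by (intro mult_mono) auto
    then show False
      using \<open>n * n' = 4\<close> by simp
  qed
  ultimately show ?thesis
    by (simp add: ns)
qed

theorem theorem1p7:
  fixes r :: nat and ms ns :: "nat list"
    and P E :: "nat list graph" and G :: "(nat list \<times> nat list) graph" and c4 :: nat
  assumes "r \<in> {0, 1}"
    and "length ns \<ge> 1"
    and "r + length ms \<ge> 1"
    and "\<forall>m\<in>set ms. m \<ge> 3"
    and "\<forall>n\<in>set ns. n \<ge> 2"
    and "sorted ns"
    and "P = cart_prods (replicate r (path_graph 2) @ map path_graph ms)"
    and "E = cart_prods (map (\<lambda>n. cycle_graph (2 * n)) ns)"
    and "G = P \<box> E"
    and "c4 = card {i. i < length ns \<and> ns ! i = 2}"
  shows
    "let case1 = (P \<simeq> path_graph 2 \<and> length ns = 1);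
         case2 = (P \<simeq> path_graph 2 \<and> E \<simeq> cycle_graph 4 \<box> cycle_graph 4);
         case3a = (P \<simeq> path_graph 2 \<and> c4 = 0 \<and> length ns \<ge> 2);
         case3b = (P \<simeq> path_graph 2 \<and>
           (\<exists>n\<ge>1. E \<simeq> cycle_graph 4 \<box> cycle_graph 4 \<box> cycle_graph (4 * n + 2)));
         case3c = ((\<exists>m\<ge>3. P \<simeq> path_graph 2 \<box> path_graph m) \<and> c4 = 0)
     in (case1 \<longrightarrow> q_B G = 4) \<and>
        (case2 \<longrightarrow> q_B G = 6) \<and>
        (case3a \<or> case3b \<or> case3c \<longrightarrow> max_degree G \<le> q_B G \<and> q_B G \<le> max_degree G + 1) \<and>
        (\<not> case1 \<and> \<not> case2 \<and> \<not> case3a \<and> \<not> case3b \<and> \<not> case3c \<longrightarrow> q_B G = max_degree G)"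
proof -
  define ns' where "ns' = filter (\<lambda>n. n \<noteq> 2) ns"
  let ?Ps = "replicate r (path_graph 2) @ map path_graph ms"
  let ?Es = "map (\<lambda>n. cycle_graph (2 * n)) ns"
  have c4: "c4 = length (filter (\<lambda>n. n = 2) ns)"
    using assms(10) by (simp add: length_filter_conv_card)
  have "filter (\<lambda>n. n = 2) ns = replicate c4 2"
    unfolding c4 by (induction ns) auto
  then have mset_ns: "mset ns = mset (replicate c4 2 @ ns')"
    unfolding ns'_def using multiset_partition[of "mset ns" "\<lambda>n. n = 2"] by (metis mset_append mset_filter)
  have mset_Es: "mset ?Es = mset (replicate c4 (cycle_graph 4) @ map (\<lambda>n. cycle_graph (2 * n)) ns')"
    using arg_cong[OF mset_ns, of "image_mset (\<lambda>n. cycle_graph (2 * n))"] by simp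
  have length_ns: "length ns = c4 + length ns'"
    using arg_cong[OF mset_ns, of size] by simp
  have ns': "\<forall>n\<in>set ns'. n \<ge> 3"
    using assms(5) by (force simp: ns'_def)
  have factors: "factor H" if "H \<in> set (?Ps @ ?Es)" for H
    using that assms(4,5) by (auto intro!: factor_path_graph factor_cycle_graph)
  have simple: "fin_simple_graph P" "fin_simple_graph E" "fin_simple_graph G"
    using factors unfolding assms(7,8,9)
    by (auto intro!: fin_simple_cart_prods fin_simple_cart_prod simp: factor_def)
  have G: "G \<simeq> cart_prods (?Ps @ ?Es)"
    unfolding assms(7,8,9) by (rule cart_prods_append)
  have "max_degree G = max_degree (cart_prods (?Ps @ ?Es))"
    using factors by (intro max_degree_iso[OF simple(3) _ G] fin_simple_cart_prods) (auto simp: factor_def)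
  also have "\<dots> = sum_list (map max_degree (?Ps @ ?Es))"
    using factors by (intro max_degree_cart_prods) (auto simp: factor_def)
  also have "map max_degree (?Ps @ ?Es) = replicate r 1 @ map (\<lambda>_. 2) ms @ map (\<lambda>_. 2) ns"
    using assms(4,5) by (auto simp: max_degree_path_graph_2 max_degree_path_graph max_degree_cycle_graph)
  finally have deg: "max_degree G = r + 2 * (length ms + c4 + length ns')"
    by (simp add: sum_list_triv sum_list_replicate length_ns)
  have q_le: "q_B G \<le> k" if "factors_colorable (replicate r (path_graph 2) @ family ms c4 ns') k" for k
  proof (rule q_B_le[OF simple(3)], rule B_colorable_iso[OF simple(3)])
    show "B_colorable (cart_prods (replicate r (path_graph 2) @ family ms c4 ns')) k"
      using that by (simp add: factors_colorable_def)
    have "cart_prods (?Ps @ ?Es) \<simeq> cart_prods (replicate r (path_graph 2) @ family ms c4 ns')"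
      using mset_Es by (intro cart_prods_mset_cong) simp
    with G show "G \<simeq> cart_prods (replicate r (path_graph 2) @ family ms c4 ns')"
      by (rule graph_iso_trans)
  qed
  have colorable: "B_colorable G (q_B G)"
    by (rule B_colorable_q_B[OF simple(3)])
  have "verts P \<noteq> {}" "verts E \<noteq> {}"
    unfolding assms(7,8) using factors
    by (intro verts_cart_prods_nonempty ballI; auto simp: factor_def)+
  then have "verts G \<noteq> {}"
    by (simp add: assms(9))
  then have lower: "max_degree G \<le> q_B G"
    using max_degree_le_B_colorable[OF simple(3) _ colorable] by simp
  have r: "r = 0 \<or> r = 1"
    using assms(1) by simp
  have upper_0: "q_B G \<le> max_degree G" if "r = 0"
  proof -
    \<comment> \<open>Without the edge there is at least one path, which can absorb a leftover
      4-cycle.\<close>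
    have "ms \<noteq> []"
      using that assms(3) by auto
    then have "factors_colorable (replicate r (path_graph 2) @ family ms c4 ns') (2 * (length ms + c4 + length ns'))"
      using colorable_family[OF assms(4) ns'] that by simp
    from q_le[OF this] show ?thesis
      using deg that by simp
  qed
  have upper_1: "q_B G \<le> max_degree G + 1" if "r = 1"
  proof -
    have "factors_colorable (replicate r (path_graph 2) @ family ms c4 ns') (2 + 2 * (length ms + c4 + length ns'))"
      using colorable_path_2_family_upper[OF assms(4) ns'] that by simp
    from q_le[OF this] show ?thesis
      using deg that by simp
  qed
  have upper: "q_B G \<le> max_degree G + 1"
    using r upper_0 upper_1 by linarith
  have P_iff: "P \<simeq> path_graph 2 \<longleftrightarrow> r = 1 \<and> ms = []"
    unfolding assms(7) using assms(1,4) by (intro path_2_product_iff) auto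
  have case1: "q_B G = 4" if *: "r = 1" "ms = []" "length ns = 1"
  proof -
    obtain n where n: "ns = [n]" "n \<ge> 2"
      using *(3) assms(5) by (auto simp: length_Suc_conv)
    \<comment> \<open>One edge of each factor spans a 4-cycle, which lifts the lower bound from the
      degree 3 to 4.\<close>
    have "adj P [0] [1]" "adj E [0] [1]"
      using n * unfolding assms(7,8)
      by (simp_all add: adj_cart_prods_Cons adj_cart_prod adj_path_graph adj_cycle_graph del: cart_prods.simps(2))
    then have "4 \<le> q_B G"
      using adj_verts[OF simple(1)] adj_verts[OF simple(2)]
      by (intro B_colorable_four_cycle[OF colorable, of "([0], [0])" "([1], [0])" "([1], [1])" "([0], [1])"])
        (auto simp: assms(9) adj_cart_prod intro: adj_sym)
    then show ?thesis
      using upper deg that length_ns by simp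
  qed
  have case2: "q_B G = 6" if "r = 1" "ms = []" "E \<simeq> cycle_graph 4 \<box> cycle_graph 4"
  proof -
    have ns: "ns = [2, 2]"
      using C4_C4_product[OF assms(5)] that(3) unfolding assms(8) by simp
    let ?Q = "[path_graph 2, path_graph 2, path_graph 2, path_graph 2, path_graph 2]"
    \<comment> \<open>Here \<open>G\<close> is the 5-dimensional cube, so the general bounds leave
      only 5 and 6.\<close>
    have "cart_prods ?Q \<simeq> cart_prods [path_graph 2, cycle_graph 4, cycle_graph 4]"
      by (intro cart_prods_path_2_path_2_cong cart_prods_Cons_cong graph_iso_refl)
    also have "\<dots> \<simeq> G"
      using graph_iso_sym[OF G] by (simp add: ns that)
    finally have "cart_prods ?Q \<simeq> G" .
    moreover have "fin_simple_graph (cart_prods ?Q)"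
      by (intro fin_simple_cart_prods) (simp add: fin_simple_path_graph)
    ultimately have "\<not> B_colorable G 5"
      using B_colorable_iso not_B_colorable_cube_5 by (auto simp: numeral_eq_Suc)
    moreover have "max_degree G = 5"
      using deg length_ns ns that by simp
    ultimately show ?thesis
      using lower upper colorable by (cases "q_B G = 5") auto
  qed
  have case4: "q_B G = max_degree G"
    if not1: "\<not> (P \<simeq> path_graph 2 \<and> length ns = 1)"
      and not2: "\<not> (P \<simeq> path_graph 2 \<and> E \<simeq> cycle_graph 4 \<box> cycle_graph 4)"
      and not3a: "\<not> (P \<simeq> path_graph 2 \<and> c4 = 0 \<and> length ns \<ge> 2)"
      and not3b: "\<not> (P \<simeq> path_graph 2 \<and>
        (\<exists>n\<ge>1. E \<simeq> cycle_graph 4 \<box> cycle_graph 4 \<box> cycle_graph (4 * n + 2)))"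
      and not3c: "\<not> ((\<exists>m\<ge>3. P \<simeq> path_graph 2 \<box> path_graph m) \<and> c4 = 0)"
    using r
  proof
    assume "r = 0"
    then show ?thesis
      using upper_0 lower by simp
  next
    assume "r = 1"
    have rep: "replicate 2 H = [H, H]" for H :: "nat graph"
      by (simp add: numeral_2_eq_2)
    have E: "E \<simeq> cart_prods (replicate c4 (cycle_graph 4) @ map (\<lambda>n. cycle_graph (2 * n)) ns')"
      unfolding assms(8) by (rule cart_prods_mset_cong[OF mset_Es])
    have "factors_colorable (path_graph 2 # family ms c4 ns') (1 + 2 * (length ms + c4 + length ns'))"
    \<comment> \<open>Each assumption of this rule comes from the negation of one exceptional case;
      for this, only the direction from the shape of the factor lists to the isomorphism is
      required.\<close>
    proof (rule colorable_path_2_family[OF assms(4) ns'])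
      assume "ms = []"
      then have P: "P \<simeq> path_graph 2"
        using P_iff \<open>r = 1\<close> by simp
      then have ns2: "length ns \<ge> 2"
        using not1 assms(2) by simp
      then have "c4 \<ge> 1"
        using not3a P by simp
      moreover have "(c4, ns') \<noteq> (2, [])"
      proof
        assume "(c4, ns') = (2, [])"
        then have "E \<simeq> cart_prods [cycle_graph 4, cycle_graph 4]"
          using E rep by simp
        then have "E \<simeq> cycle_graph 4 \<box> cycle_graph 4"
          by (rule graph_iso_trans) (intro cart_prods_Cons_iso cart_prods_single)
        then show False
          using not2 P by simp
      qed
      moreover have "(c4, ns') \<noteq> (2, [n])" if "odd n" for n
      proof
        assume *: "(c4, ns') = (2, [n])"
        then have "n \<ge> 3"
          using ns' by simp
        \<comment> \<open>An odd half-length \<open>2 * k + 1\<close> gives a cycle of length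
          \<open>4 * k + 2\<close>.\<close>
        with that obtain k where k: "n = 2 * k + 1" "k \<ge> 1"
          by (auto elim!: oddE)
        have "replicate c4 (cycle_graph 4) @ map (\<lambda>n. cycle_graph (2 * n)) ns' =
            [cycle_graph 4, cycle_graph 4, cycle_graph (4 * k + 2)]"
          using * k rep by simp
        with E have "E \<simeq> cart_prods [cycle_graph 4, cycle_graph 4, cycle_graph (4 * k + 2)]"
          by (simp only:)
        then have "E \<simeq> cycle_graph 4 \<box> cycle_graph 4 \<box> cycle_graph (4 * k + 2)"
          by (rule graph_iso_trans) (intro cart_prods_Cons_iso cart_prods_single)
        then show False
          using not3b P k by blast
      qed
      ultimately show "c4 \<ge> 1 \<and> c4 + length ns' \<ge> 2 \<and> (c4, ns') \<noteq> (2, []) \<and>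
          (\<forall>n. odd n \<longrightarrow> (c4, ns') \<noteq> (2, [n]))"
        using ns2 length_ns by simp
    next
      assume "length ms = 1"
      then obtain m where m: "ms = [m]" "m \<ge> 3"
        using assms(4) by (auto simp: length_Suc_conv)
      have "P \<simeq> path_graph 2 \<box> path_graph m"
        using cart_prods_Cons_iso[OF cart_prods_single, of "path_graph 2" "path_graph m"] m \<open>r = 1\<close>
        unfolding assms(7) by simp
      then show "c4 \<ge> 1"
        using not3c m(2) by (cases c4) auto
    qed
    then have "factors_colorable (replicate r (path_graph 2) @ family ms c4 ns') (1 + 2 * (length ms + c4 + length ns'))"
      using \<open>r = 1\<close> by simp
    from q_le[OF this] show ?thesis
      using deg lower \<open>r = 1\<close> by simp
  qed
  show ?thesis
    unfolding Let_def using case1 case2 case4 lower upper P_iff by blast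
qed

end
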